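(* Let $\mathbb{F}_q$ be a finite field with $q$ elements, let $n,m\ge 1$ be integers, and let $\chi$ be a nontrivial (multiplicative) character of $\mathbb{F}_q$. Let $$F_\chi(n,m,q):=\sum_{f,g}\chi(\mathcal{R}(f,g)),$$ where $f$ and $g$ range over the monic square-free polynomials over $\mathbb{F}_q$ of degrees $n$ and $m$ respectively, and $\mathcal{R}(f,g)$ is their resultant. Then $$|F_\chi(n,m,q)| \le 2^{2n+2m-1}\,\frac{q^{\,n+m+1-\max(n,m)/2}-1}{\sqrt{q}-1}$$ if $\chi$ is quadratic, and $$|F_\chi(n,m,q)| \le 2^{2n+2m-1}\,\frac{q^{\,n+m+(1-\max(n,m))/2}-1}{\sqrt{q}-1}$$ otherwise.
   Context: For monic polynomials $f,g\in\mathbf{k}[x]$ of positive degrees over a field $\mathbf{k}$, the resultant is $\mathcal{R}(f,g)=\prod_{i,j}(x_i-y_j)\in\mathbf{k}$, where $x_1,\dots,x_n$ are the roots of $f$ and $y_1,\dots,y_m$ the roots of $g$ (with multiplicity) in an algebraically closed extension of $\mathbf{k}$. A character $\chi$ of $\mathbb{F}_q$ here means a group homomorphism $\mathbb{F}_q^\times\to\mathbb{C}^\times$, extended to a function $\chi:\mathbb{F}_q\to\mathbb{C}$ by $\chi(0)=0$; it is nontrivial if it is not identically $1$ on $\mathbb{F}_q^\times$, and quadratic if it has order exactly $2$. *)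

theory Defs
  imports Complex_Main "HOL-Library.Cardinality" "HOL-Algebra.Algebraic_Closure_Type"
begin

section \<open>Resultants of monic polynomials\<close>

text \<open>
  Sums and products over \<open>proots\<close> run over a multiset, so roots are counted with multiplicity.
  The product of the root differences lives in the algebraic closure; \<open>of_ac\<close> moves it back to
  the base field and would return a junk value outside the image of the base field.
  The lemma \<open>to_ac_poly_resultant\<close> below shows that this never happens.
\<close>

definition poly_resultant :: "'a :: field poly \<Rightarrow> 'a poly \<Rightarrow> 'a" where
  "poly_resultant f g =
     of_ac (\<Prod>x\<in>#proots (map_poly to_ac f). \<Prod>y\<in>#proots (map_poly to_ac g). x - y)"

lemma proots_prod_linear:
  "proots (\<Prod>x\<in>#A. [:-x, 1:]) = (A :: 'a :: idom multiset)"
proof (induction A)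
  case (add x A)
  have "(\<Prod>x\<in>#A. [:-x, 1:]) \<noteq> (0 :: 'a poly)"
    by (auto simp: prod_mset_zero_iff)
  hence "proots ([:-x, 1:] * (\<Prod>x\<in>#A. [:-x, 1:])) = proots [:-x, 1:] + A"
    by (subst proots_mult) (auto simp: add)
  thus ?case by (simp del: mult_pCons_left)
qed auto

lemma monic_eq_prod_proots:
  fixes p :: "'a :: alg_closed_field poly"
  assumes "lead_coeff p = 1"
  shows "p = (\<Prod>x\<in>#proots p. [:-x, 1:])"
proof -
  have "p \<noteq> 0" using assms by auto
  then obtain A where "p = smult (lead_coeff p) (\<Prod>x\<in>#A. [:-x, 1:])"
    using alg_closed_imp_factorization by blast
  hence A: "p = (\<Prod>x\<in>#A. [:-x, 1:])"
    using assms by simp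
  hence "proots p = A"
    using proots_prod_linear[of A] by simp
  thus ?thesis using A by simp
qed

lemma poly_monic_eq_prod_proots:
  fixes p :: "'a :: alg_closed_field poly"
  assumes "lead_coeff p = 1"
  shows "poly p a = (\<Prod>x\<in>#proots p. a - x)"
proof -
  have "poly (\<Prod>x\<in>#A. [:-x, 1:]) a = (\<Prod>x\<in>#A. a - x)" for A :: "'a multiset"
    by (induction A) (auto simp: algebra_simps)
  thus ?thesis
    using monic_eq_prod_proots[OF assms] by metis
qed

lemma map_poly_to_ac_add: "map_poly to_ac (p + q) = map_poly to_ac p + map_poly to_ac q"
  by (rule poly_eqI) (simp add: coeff_map_poly)

lemma map_poly_to_ac_smult: "map_poly to_ac (Polynomial.smult c p) = Polynomial.smult (to_ac c) (map_poly to_ac p)"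
  by (rule poly_eqI) (simp add: coeff_map_poly)

lemma map_poly_to_ac_mult: "map_poly to_ac (p * q) = map_poly to_ac p * map_poly to_ac q"
  by (rule poly_eqI) (simp add: coeff_map_poly coeff_mult to_ac_sum)

lemma degree_map_poly_to_ac [simp]: "Polynomial.degree (map_poly to_ac p) = Polynomial.degree p"
  by (rule degree_map_poly) auto

lemma lead_coeff_map_poly_to_ac: "lead_coeff (map_poly to_ac p) = to_ac (lead_coeff p)"
  by (simp add: coeff_map_poly)

lemma prod_proots_swap:
  fixes A B :: "'a :: comm_ring_1 multiset"
  shows "(\<Prod>x\<in>#A. \<Prod>y\<in>#B. x - y) = (-1) ^ (size A * size B) * (\<Prod>y\<in>#B. \<Prod>x\<in>#A. y - x)"
proof -
  have minus: "(\<Prod>y\<in>#B. x - y) = (-1) ^ size B * (\<Prod>y\<in>#B. y - x)" for x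
  proof (induction B)
    case (add b B)
    have "(\<Prod>y\<in>#add_mset b B. x - y) = (x - b) * ((-1) ^ size B * (\<Prod>y\<in>#B. y - x))"
      using add by simp
    thus ?case by (simp add: algebra_simps)
  qed auto
  have "(\<Prod>x\<in>#A. \<Prod>y\<in>#B. x - y) = (-1) ^ (size A * size B) * (\<Prod>x\<in>#A. \<Prod>y\<in>#B. y - x)"
    unfolding minus by (induction A) (auto simp: power_add algebra_simps)
  also have "(\<Prod>x\<in>#A. \<Prod>y\<in>#B. y - x) = (\<Prod>y\<in>#B. \<Prod>x\<in>#A. y - x)"
    by (induction A) (auto simp: prod_mset.distrib)
  finally show ?thesis .
qed

lemma prod_poly_proots_in_range_to_ac:
  fixes f g :: "'a :: field poly"
  assumes "lead_coeff f = 1"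
  shows "(\<Prod>x\<in>#proots (map_poly to_ac f). poly (map_poly to_ac g) x) \<in> range to_ac"
  using assms
proof (induction "Polynomial.degree f" arbitrary: f g rule: less_induct)
  case (less f g)
  define F where "F = proots (map_poly to_ac f)"
  have f0: "f \<noteq> 0" using less.prems by auto
  define r where "r = g mod f"
  have root: "poly (map_poly to_ac f) x = 0" if "x \<in># F" for x
  proof -
    have "map_poly to_ac f \<noteq> 0" using f0 degree_map_poly_to_ac lead_coeff_map_poly_to_ac
      by (metis less.prems leading_coeff_0_iff to_ac_1 zero_neq_one)
    thus ?thesis using that unfolding F_def by simp
  qed
  have "poly (map_poly to_ac g) x = poly (map_poly to_ac r) x" if "x \<in># F" for x
  proof -
    have "g = (g div f) * f + r" by (simp add: r_def)
    hence "map_poly to_ac g = map_poly to_ac (g div f) * map_poly to_ac f + map_poly to_ac r"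
      by (metis map_poly_to_ac_add map_poly_to_ac_mult)
    thus ?thesis using root[OF that] by simp
  qed
  hence eq: "(\<Prod>x\<in>#F. poly (map_poly to_ac g) x) = (\<Prod>x\<in>#F. poly (map_poly to_ac r) x)"
    by (intro arg_cong[where f = prod_mset] image_mset_cong) auto
  show ?case
  proof (cases "r = 0")
    case True
    have "(\<Prod>x\<in>#F. poly (map_poly to_ac r) x) = to_ac (0 ^ size F)"
      using True by (induction F) auto
    thus ?thesis using eq unfolding F_def by (metis rangeI)
  next
    case False
    have deg: "Polynomial.degree r < Polynomial.degree f"
      using degree_mod_less[OF f0, of g] False by (auto simp: r_def)
    define c where "c = lead_coeff r"
    define s where "s = Polynomial.smult (inverse c) r"
    have c: "c \<noteq> 0" using False by (auto simp: c_def)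
    have s: "lead_coeff s = 1" "Polynomial.degree s = Polynomial.degree r"
      "r = Polynomial.smult c s"
      using c by (auto simp: s_def c_def)
    define S where "S = proots (map_poly to_ac s)"
    have "(\<Prod>x\<in>#S. poly (map_poly to_ac f) x) \<in> range to_ac"
      unfolding S_def using less.hyps[of s f] deg s by simp
    then obtain d where d: "(\<Prod>x\<in>#S. poly (map_poly to_ac f) x) = to_ac d" by auto
    have "(\<Prod>x\<in>#F. poly (map_poly to_ac r) x) = to_ac c ^ size F * (\<Prod>x\<in>#F. poly (map_poly to_ac s) x)"
      unfolding s(3) map_poly_to_ac_smult by (induction F) (auto simp: algebra_simps)
    also have "(\<Prod>x\<in>#F. poly (map_poly to_ac s) x) = (\<Prod>x\<in>#F. \<Prod>y\<in>#S. x - y)"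
      unfolding S_def using s(1)
      by (subst poly_monic_eq_prod_proots) (auto simp: lead_coeff_map_poly_to_ac simp del: degree_map_poly_to_ac)
    also have "\<dots> = (-1) ^ (size F * size S) * (\<Prod>y\<in>#S. \<Prod>x\<in>#F. y - x)"
      by (rule prod_proots_swap)
    also have "(\<Prod>y\<in>#S. \<Prod>x\<in>#F. y - x) = (\<Prod>y\<in>#S. poly (map_poly to_ac f) y)"
      unfolding F_def using less.prems
      by (subst poly_monic_eq_prod_proots[of "map_poly to_ac f"]) (simp_all add: coeff_map_poly)
    also note d
    also have "to_ac c ^ size F * ((-1) ^ (size F * size S) * to_ac d) =
               to_ac (c ^ size F * ((-1) ^ (size F * size S) * d))"
      by simp
    finally show ?thesis using eq unfolding F_def by (metis rangeI)
  qed
qed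

lemma to_ac_poly_resultant:
  fixes f g :: "'a :: field poly"
  assumes "lead_coeff f = 1" "lead_coeff g = 1"
  shows "to_ac (poly_resultant f g) =
           (\<Prod>x\<in>#proots (map_poly to_ac f). \<Prod>y\<in>#proots (map_poly to_ac g). x - y)"
proof -
  have "poly (map_poly to_ac g) = (\<lambda>x. \<Prod>y\<in>#proots (map_poly to_ac g). x - y)"
    using assms(2) by (intro ext poly_monic_eq_prod_proots) (simp add: coeff_map_poly)
  hence "(\<Prod>x\<in>#proots (map_poly to_ac f). \<Prod>y\<in>#proots (map_poly to_ac g). x - y) \<in> range to_ac"
    using prod_poly_proots_in_range_to_ac[OF assms(1), of g] by simp
  thus ?thesis
    unfolding poly_resultant_def by (rule to_ac_of_ac)
qed


section \<open>Multiplicative characters\<close>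

text \<open>
  A homomorphism from the unit group of a field to the unit group of the complex numbers, extended
  by 0 at 0.
\<close>

definition mult_character :: "('a :: field \<Rightarrow> complex) \<Rightarrow> bool" where
  "mult_character \<chi> \<longleftrightarrow>
     \<chi> 0 = 0 \<and> (\<forall>x. x \<noteq> 0 \<longrightarrow> \<chi> x \<noteq> 0) \<and>
     (\<forall>x y. x \<noteq> 0 \<longrightarrow> y \<noteq> 0 \<longrightarrow> \<chi> (x * y) = \<chi> x * \<chi> y)"

definition nontrivial_character :: "('a :: field \<Rightarrow> complex) \<Rightarrow> bool" where
  "nontrivial_character \<chi> \<longleftrightarrow> \<not> (\<forall>x. x \<noteq> 0 \<longrightarrow> \<chi> x = 1)"

text \<open>
  The order of a character in the character group. Over a finite field the least element exists,
  because the \<open>(q - 1)\<close>-st power of every character is trivial.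
\<close>

definition character_order :: "('a :: field \<Rightarrow> complex) \<Rightarrow> nat" where
  "character_order \<chi> = (LEAST k. k > 0 \<and> (\<forall>x. x \<noteq> 0 \<longrightarrow> \<chi> x ^ k = 1))"

definition quadratic_character :: "('a :: field \<Rightarrow> complex) \<Rightarrow> bool" where
  "quadratic_character \<chi> \<longleftrightarrow> character_order \<chi> = 2"

lemma mult_character_power_eq_1:
  fixes \<chi> :: "'a :: {finite, field} \<Rightarrow> complex"
  assumes "mult_character \<chi>" "x \<noteq> 0"
  shows "\<chi> x ^ (CARD('a) - 1) = 1"
proof -
  let ?U = "UNIV - {0 :: 'a}"
  have "(\<Prod>y\<in>?U. \<chi> y) = (\<Prod>y\<in>?U. \<chi> (x * y))"
    by (rule prod.reindex_bij_witness[of _ "\<lambda>y. x * y" "\<lambda>y. y / x"]) (use assms(2) in auto)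
  also have "\<dots> = (\<Prod>y\<in>?U. \<chi> x * \<chi> y)"
    using assms by (intro prod.cong) (auto simp: mult_character_def)
  also have "\<dots> = \<chi> x ^ card ?U * (\<Prod>y\<in>?U. \<chi> y)"
    by (simp add: prod.distrib)
  finally have "(\<Prod>y\<in>?U. \<chi> y) = \<chi> x ^ card ?U * (\<Prod>y\<in>?U. \<chi> y)" .
  moreover have "(\<Prod>y\<in>?U. \<chi> y) \<noteq> 0"
    using assms by (auto simp: mult_character_def)
  ultimately show ?thesis by (simp add: card_Diff_singleton)
qed

lemma card_finite_field_gt_1: "CARD('a :: {finite, field}) > 1"
proof -
  have "card {0, 1 :: 'a} \<le> CARD('a)" by (intro card_mono) auto
  thus ?thesis by simp
qed

lemma quadratic_character_iff:
  fixes \<chi> :: "'a :: {finite, field} \<Rightarrow> complex"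
  assumes "mult_character \<chi>"
  shows "quadratic_character \<chi> \<longleftrightarrow>
           nontrivial_character \<chi> \<and> (\<forall>x. x \<noteq> 0 \<longrightarrow> \<chi> x ^ 2 = 1)"
proof -
  define P where "P k \<longleftrightarrow> k > 0 \<and> (\<forall>x. x \<noteq> 0 \<longrightarrow> \<chi> x ^ k = 1)" for k :: nat
  have "P (CARD('a) - 1)"
    using mult_character_power_eq_1[OF assms] card_finite_field_gt_1[where 'a = 'a]
    by (auto simp: P_def)
  hence L: "P (Least P)" by (rule LeastI)
  have ord: "character_order \<chi> = Least P"
    unfolding character_order_def P_def ..
  have nt: "nontrivial_character \<chi> \<longleftrightarrow> \<not> P 1"
    by (auto simp: nontrivial_character_def P_def)
  have P2: "(\<forall>x. x \<noteq> 0 \<longrightarrow> \<chi> x ^ 2 = 1) \<longleftrightarrow> P 2"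
    by (simp add: P_def)
  have "Least P = 2 \<longleftrightarrow> \<not> P 1 \<and> P 2"
  proof
    assume "Least P = 2"
    thus "\<not> P 1 \<and> P 2" using L Least_le[of P 1] by auto
  next
    assume *: "\<not> P 1 \<and> P 2"
    have "Least P \<le> 2" using * by (auto intro: Least_le)
    moreover have "Least P \<noteq> 0" using L by (auto simp: P_def)
    moreover have "Least P \<noteq> 1" using L * by metis
    ultimately show "Least P = 2" by linarith
  qed
  thus ?thesis by (simp add: quadratic_character_def ord nt P2)
qed


section \<open>The resultant character sum\<close>

definition monic_squarefree_polys :: "nat \<Rightarrow> 'a :: field poly set" where
  "monic_squarefree_polys n = {f. lead_coeff f = 1 \<and> Polynomial.degree f = n \<and> squarefree f}"

lemma finite_monic_squarefree_polys:
  "finite (monic_squarefree_polys n :: 'a :: {finite, field} poly set)"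
proof (rule finite_subset)
  show "monic_squarefree_polys n \<subseteq> Poly ` {xs :: 'a list. set xs \<subseteq> UNIV \<and> length xs = Suc n}"
  proof
    fix f :: "'a poly" assume f: "f \<in> monic_squarefree_polys n"
    hence "f \<noteq> 0" by (auto simp: monic_squarefree_polys_def)
    hence "length (Polynomial.coeffs f) = Suc n"
      using f by (simp add: length_coeffs monic_squarefree_polys_def)
    thus "f \<in> Poly ` {xs :: 'a list. set xs \<subseteq> UNIV \<and> length xs = Suc n}"
      by (intro image_eqI[of _ _ "Polynomial.coeffs f"]) auto
  qed
qed (intro finite_imageI finite_lists_length_eq, simp)

text \<open>The parameter \<open>q\<close> is the cardinality of the type \<open>'a\<close>.\<close>

definition resultant_sum :: "('a :: {finite, field} \<Rightarrow> complex) \<Rightarrow> nat \<Rightarrow> nat \<Rightarrow> complex" where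
  "resultant_sum \<chi> n m =
     (\<Sum>f\<in>monic_squarefree_polys n. \<Sum>g\<in>monic_squarefree_polys m. \<chi> (poly_resultant f g))"

end

theory Submission
  imports Defs "HOL-Analysis.L2_Norm"
begin

text \<open>
  For monic \<open>g\<close> put \<open>N\<^sub>g(a) = \<Prod> a(y)\<close>, the product over the roots \<open>y\<close> of \<open>g\<close>
  (\<open>residue_norm\<close>). This is the norm from
  \<open>F\<^sub>q[t]/(g)\<close> to \<open>F\<^sub>q\<close>, and the resultant of \<open>f\<close> and \<open>g\<close> is \<open>N\<^sub>f(g) = \<plusminus>N\<^sub>g(f)\<close>. For squarefree \<open>g\<close> the
  function \<open>a \<mapsto> \<chi>(N\<^sub>g(a))\<close> is a primitive multiplicative character modulo \<open>g\<close>. Let \<open>S\<^sub>k(g)\<close>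
  (\<open>full_sum\<close>) and \<open>T\<^sub>k(g)\<close> (\<open>sqfree_sum\<close>) be the sums of this character over all monic, respectively all monic squarefree, polynomials of
  degree \<open>k\<close>. By symmetry let \<open>n \<ge> m\<close>; the sum in question is at most \<open>\<Sum> \<bar>T\<^sub>n(g)\<bar>\<close>, where \<open>g\<close> runs over
  the squarefree monic polynomials of degree \<open>m\<close>.

  For a single \<open>g\<close> the right size of these sums is the Riemann hypothesis for an L-function, that is, a
  theorem of Weil. Since there is an average over \<open>g\<close>, it is enough to know their mean square, and this is
  elementary:

  \<^item> If \<open>2k \<le> m\<close>, then expanding the square of \<open>T\<^sub>k\<close> and summing over all monic \<open>g\<close> of degree \<open>m\<close> leaves
    only the diagonal (\<open>sqfree_orthogonality\<close>): by reciprocity \<open>g\<close> becomes the argument of a character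
    modulo \<open>h\<^sub>1h\<^sub>2\<close>, which is nontrivial unless \<open>h\<^sub>1 = h\<^sub>2\<close>, and the sum runs over complete residue
    systems. So \<open>\<Sum> \<bar>T\<^sub>k(g)\<bar>\<^sup>2 \<le> q\<^bsup>m+k\<^esup>\<close>.

  \<^item> The unique factorisation \<open>h = d\<^sup>2s\<close> with squarefree \<open>s\<close> expresses \<open>S\<^sub>k\<close> by the \<open>T\<^sub>k\<^sub>-\<^sub>2\<^sub>j\<close>, with
    coefficients of size at most \<open>q\<^sup>j\<close>, and it can be inverted. This transports square root size
    between \<open>T\<close> and \<open>S\<close> at the cost of powers of 2.

  \<^item> If \<open>m < 2k < 2m\<close>, the functional equation (\<open>functional_equation\<close>) replaces \<open>S\<^sub>k\<close> by a combination of
    the \<open>S\<^sub>i\<close> with \<open>i \<le> m - 1 - k\<close>, to which the first two points apply. The loss is exactly the right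
    power of \<open>q\<close>, because Gauss sums have square root size. For \<open>k \<ge> m\<close> the sum \<open>S\<^sub>k\<close> vanishes.

  With the Cauchy-Schwarz inequality this gives the bound \<open>2\<^bsup>n+m\<^esup> q\<^bsup>m + n/2\<^esup>\<close> for every nontrivial
  character. As \<open>(x\<^bsup>K+1\<^esup> - 1)/(x - 1) \<ge> x\<^sup>K\<close> for \<open>x = \<surd>q\<close>, it is stronger than both inequalities of the
  theorem.

  Both orthogonality and primitivity rest on one fact: the norm from the field \<open>F\<^sub>q[t]/(P)\<close>, for irreducible
  \<open>P\<close>, is onto \<open>F\<^sub>q\<close> (\<open>residue_norm_surj\<close>), so that \<open>\<chi>\<close> composed with it is still nontrivial.
\<close>

section \<open>Polynomial arithmetic over a field\<close>

definition monic_polys :: "nat \<Rightarrow> 'a :: field poly set" where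
  "monic_polys k = {f. lead_coeff f = 1 \<and> Polynomial.degree f = k}"

definition polys_below :: "nat \<Rightarrow> 'a :: field poly set" where
  "polys_below k = {a. \<forall>i\<ge>k. Polynomial.coeff a i = 0}"

lemma polys_below_iff: "a \<in> polys_below k \<longleftrightarrow> a = 0 \<or> Polynomial.degree a < k"
proof
  assume a: "a \<in> polys_below k"
  show "a = 0 \<or> Polynomial.degree a < k"
  proof (rule ccontr)
    assume "\<not> ?thesis"
    hence "a \<noteq> 0" "Polynomial.degree a \<ge> k" by auto
    thus False using a by (auto simp: polys_below_def)
  qed
qed (auto simp: polys_below_def coeff_eq_0)

lemma polys_below_add: "a \<in> polys_below k \<Longrightarrow> b \<in> polys_below k \<Longrightarrow> a + b \<in> polys_below k"
  by (auto simp: polys_below_def)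

lemma polys_below_diff: "a \<in> polys_below k \<Longrightarrow> b \<in> polys_below k \<Longrightarrow> a - b \<in> polys_below k"
  by (auto simp: polys_below_def)

lemma zero_in_polys_below [simp]: "0 \<in> polys_below k"
  by (auto simp: polys_below_def)

lemma polys_below_0 [simp]: "polys_below 0 = {0}"
  by (auto simp: polys_below_def poly_eq_iff)

lemma polys_below_Suc: "polys_below (Suc k) = (\<lambda>(c, a). pCons c a) ` (UNIV \<times> polys_below k)"
proof (intro equalityI subsetI)
  fix a :: "'a poly" assume a: "a \<in> polys_below (Suc k)"
  obtain c b where cb: "a = pCons c b" by (cases a)
  have "b \<in> polys_below k"
    unfolding polys_below_def
  proof (safe)
    fix i assume "k \<le> i"
    thus "Polynomial.coeff b i = 0" using a cb by (auto simp: polys_below_def dest: spec[of _ "Suc i"])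
  qed
  thus "a \<in> (\<lambda>(c, a). pCons c a) ` (UNIV \<times> polys_below k)" using cb by force
qed (auto simp: polys_below_def coeff_pCons split: nat.splits)

lemma card_polys_below:
  "finite (polys_below k :: 'a :: {finite, field} poly set) \<and>
   card (polys_below k :: 'a poly set) = CARD('a) ^ k"
proof (induction k)
  case (Suc k)
  have "inj_on (\<lambda>(c, a). pCons c a) (UNIV \<times> (polys_below k :: 'a poly set))"
    by (auto simp: inj_on_def)
  thus ?case using Suc
    by (simp add: polys_below_Suc card_image card_cartesian_product)
qed auto

lemma finite_polys_below [simp]: "finite (polys_below k :: 'a :: {finite, field} poly set)"
  using card_polys_below by blast

lemma monic_poly_eq_monom_add:
  "f \<in> monic_polys k \<longleftrightarrow> f - Polynomial.monom 1 k \<in> polys_below k"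
proof
  assume f: "f \<in> monic_polys k"
  have "Polynomial.coeff f i = 0" if "i > k" for i
    using f that by (auto simp: monic_polys_def coeff_eq_0)
  thus "f - Polynomial.monom 1 k \<in> polys_below k"
    using f by (auto simp: polys_below_def monic_polys_def le_less)
next
  assume f: "f - Polynomial.monom 1 k \<in> polys_below k"
  have c: "Polynomial.coeff f i = (if i = k then 1 else 0)" if "i \<ge> k" for i
    using f that by (auto simp: polys_below_def split: if_splits)
  have "Polynomial.degree f \<le> k" using c by (intro degree_le) auto
  moreover have "Polynomial.degree f \<ge> k" using c[of k] by (intro le_degree) auto
  ultimately show "f \<in> monic_polys k" using c[of k] by (auto simp: monic_polys_def)
qed

lemma bij_betw_monic_polys:
  "bij_betw (\<lambda>a. a + Polynomial.monom 1 k) (polys_below k) (monic_polys k)"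
  by (rule bij_betwI[where g = "\<lambda>f. f - Polynomial.monom 1 k"])
     (auto simp: monic_poly_eq_monom_add)

lemma finite_monic_polys [simp]: "finite (monic_polys k :: 'a :: {finite, field} poly set)"
  using bij_betw_finite[OF bij_betw_monic_polys] finite_polys_below by blast

lemma card_monic_polys: "card (monic_polys k :: 'a :: {finite, field} poly set) = CARD('a) ^ k"
proof -
  have "card (monic_polys k :: 'a poly set) = card (polys_below k :: 'a poly set)"
    by (rule bij_betw_same_card[OF bij_betw_monic_polys, symmetric])
  thus ?thesis using card_polys_below[where k = k and 'a = 'a] by simp
qed

lemma monic_polys_nonzero: "f \<in> monic_polys k \<Longrightarrow> f \<noteq> 0"
  by (auto simp: monic_polys_def)

lemma monic_polys_mult: "f \<in> monic_polys i \<Longrightarrow> g \<in> monic_polys j \<Longrightarrow> f * g \<in> monic_polys (i + j)"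
  using monic_polys_nonzero[of f i] monic_polys_nonzero[of g j]
  by (auto simp: monic_polys_def lead_coeff_mult degree_mult_eq)

lemma monic_squarefree_polys_subset: "monic_squarefree_polys k \<subseteq> monic_polys k"
  by (auto simp: monic_squarefree_polys_def monic_polys_def)

lemma is_unit_monic: 
  assumes "f \<in> monic_polys k" "is_unit f" shows "f = 1"
proof -
  obtain c where "f = [:c:]" using assms(2) by (auto simp: is_unit_poly_iff)
  thus ?thesis using assms(1) by (auto simp: monic_polys_def one_pCons)
qed

lemma monic_scaling:
  assumes "(f :: 'a :: field poly) \<noteq> 0"
  obtains g where "g \<in> monic_polys (Polynomial.degree f)"
    "f = Polynomial.smult (lead_coeff f) g" "g dvd f" "f dvd g"
proof
  let ?g = "Polynomial.smult (inverse (lead_coeff f)) f"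
  show "?g \<in> monic_polys (Polynomial.degree f)" using assms by (auto simp: monic_polys_def)
  show "f = Polynomial.smult (lead_coeff f) ?g" using assms by simp
  show "?g dvd f" "f dvd ?g" using assms by (auto simp: smult_dvd_iff intro: dvd_smult)
qed

text \<open>
  The Euclidean algorithm. The greatest common divisor \<open>d\<close> stays unnormalised and is used only through
  this identity.
\<close>
lemma poly_bezout:
  fixes a b :: "'a :: field poly"
  shows "\<exists>d u v. d = u * a + v * b \<and> d dvd a \<and> d dvd b"
proof (induction "if b = 0 then 0 else Suc (Polynomial.degree b)" arbitrary: a b rule: less_induct)
  case less
  show ?case
  proof (cases "b = 0")
    case True
    thus ?thesis by (intro exI[of _ a] exI[of _ 1]) auto
  next
    case False
    have "(if a mod b = 0 then 0 else Suc (Polynomial.degree (a mod b))) < Suc (Polynomial.degree b)"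
      using degree_mod_less[OF False, of a] by auto
    then obtain d u v where d: "d = u * b + v * (a mod b)" "d dvd b" "d dvd a mod b"
      using less[of "a mod b" b] False by auto
    have "d dvd a" using d(2,3) by (simp add: dvd_mod_iff)
    moreover have "d = v * a + (u - v * (a div b)) * b"
      unfolding d(1) by (subst minus_div_mult_eq_mod[symmetric]) (simp add: algebra_simps)
    ultimately show ?thesis using d(2) by blast
  qed
qed

lemma coprime_poly_bezout:
  fixes a b :: "'a :: field poly"
  assumes "coprime a b"
  obtains u v where "u * a + v * b = 1"
proof -
  obtain d u v where d: "d = u * a + v * b" "d dvd a" "d dvd b"
    using poly_bezout by blast
  hence "d dvd 1" using assms by (meson coprime_def)
  then obtain w where "1 = d * w" by (auto elim: dvdE)
  hence "(w * u) * a + (w * v) * b = 1" using d(1) by (simp add: algebra_simps)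
  thus ?thesis using that by blast
qed

lemma coprime_poly_dvd_mult:
  fixes a b :: "'a :: field poly"
  assumes "coprime a b" "a dvd b * c" shows "a dvd c"
proof -
  obtain u v where "u * a + v * b = 1" using coprime_poly_bezout[OF assms(1)] .
  hence "c = (u * a + v * b) * c" by simp
  also have "\<dots> = a * (u * c) + (b * c) * v" by (simp add: algebra_simps)
  also have "a dvd \<dots>" by (rule dvd_add[OF dvd_triv_left dvd_mult2[OF assms(2)]])
  finally show ?thesis .
qed

lemma irreducible_poly_coprime:
  fixes P w :: "'a :: field poly"
  assumes "irreducible P" "\<not> P dvd w" shows "coprime P w"
  unfolding coprime_def
proof safe
  fix c assume c: "c dvd P" "c dvd w"
  then obtain d where d: "P = c * d" by (auto elim: dvdE)
  show "c dvd 1"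
  proof (rule ccontr)
    assume "\<not> c dvd 1"
    hence "d dvd 1" using assms(1) d by (auto simp: Factorial_Ring.irreducible_def)
    hence "P dvd c" using d by (metis mult_dvd_mono dvd_refl mult.right_neutral)
    thus False using assms(2) c(2) dvd_trans by blast
  qed
qed

lemma degree_pos_if_not_unit: "a \<noteq> 0 \<Longrightarrow> \<not> is_unit (a :: 'a :: field poly) \<Longrightarrow> Polynomial.degree a > 0"
  by (metis gr0I is_unit_iff_degree)

lemma irreducible_monic_factor_exists:
  fixes a :: "'a :: field poly"
  assumes "\<not> is_unit a"
  obtains P d where "irreducible P" "P \<in> monic_polys d" "d > 0" "P dvd a"
proof -
  have irr: "\<exists>P. irreducible P \<and> P dvd a" if "\<not> is_unit a" "a \<noteq> 0" for a :: "'a poly"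
    using that
  proof (induction "Polynomial.degree a" arbitrary: a rule: less_induct)
    case less
    show ?case
    proof (cases "irreducible a")
      case False
      then obtain b c where bc: "a = b * c" "\<not> is_unit b" "\<not> is_unit c"
        using less.prems by (auto simp: Factorial_Ring.irreducible_def)
      hence "b \<noteq> 0" "c \<noteq> 0" using less.prems by auto
      hence "Polynomial.degree b < Polynomial.degree a"
        using bc degree_pos_if_not_unit[of c] by (simp add: degree_mult_eq)
      then obtain P where "irreducible P" "P dvd b" using less.hyps[of b] bc \<open>b \<noteq> 0\<close> by blast
      thus ?thesis using bc(1) by (meson dvd_mult2)
    qed auto
  qed
  have "\<exists>P. irreducible P \<and> P dvd a"
  proof (cases "a = 0")
    case True
    have "\<not> is_unit (Polynomial.monom 1 1 :: 'a poly)"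
      by (simp add: is_unit_iff_degree degree_monom_eq)
    hence "\<exists>P. irreducible P \<and> P dvd (Polynomial.monom 1 1 :: 'a poly)" by (intro irr) auto
    thus ?thesis using True by auto
  qed (use irr assms in blast)
  then obtain Q where Q: "irreducible Q" "Q dvd a" by blast
  hence Q0: "Q \<noteq> 0" "\<not> is_unit Q" by (auto simp: Factorial_Ring.irreducible_def)
  obtain P where P: "P \<in> monic_polys (Polynomial.degree Q)"
    "Q = Polynomial.smult (lead_coeff Q) P" "P dvd Q" "Q dvd P" using monic_scaling[OF Q0(1)] .
  have "irreducible P"
    unfolding Factorial_Ring.irreducible_def
  proof safe
    show "P = 0 \<Longrightarrow> False" using P(1) by (simp add: monic_polys_def)
    show "is_unit P \<Longrightarrow> False" using P(4) Q0 dvd_trans by blast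
  next
    fix x y assume xy: "P = x * y" "\<not> is_unit y"
    have "Q = (Polynomial.smult (lead_coeff Q) x) * y" using P(2) unfolding xy(1) by simp
    hence "is_unit (Polynomial.smult (lead_coeff Q) x)"
      using Q(1) xy(2) unfolding Factorial_Ring.irreducible_def by blast
    thus "is_unit x" using Q0 by (metis dvd_trans dvd_smult dvd_refl)
  qed
  moreover have "P dvd a" using P(3) Q(2) by (rule dvd_trans)
  ultimately show ?thesis using that[OF _ P(1)] degree_pos_if_not_unit[OF Q0] by simp
qed

section \<open>The norm from a residue ring\<close>

text \<open>
  The norm of \<open>a\<close> from the residue ring modulo \<open>g\<close> to the base field, computed in the algebraic closure.
  It is meaningful for monic \<open>g\<close>.
\<close>
definition residue_norm :: "'a :: field poly \<Rightarrow> 'a poly \<Rightarrow> 'a" where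
  "residue_norm g a = of_ac (\<Prod>y\<in>#proots (map_poly to_ac g). poly (map_poly to_ac a) y)"

lemma to_ac_residue_norm:
  assumes "lead_coeff g = 1"
  shows "to_ac (residue_norm g a) = (\<Prod>y\<in>#proots (map_poly to_ac g). poly (map_poly to_ac a) y)"
  unfolding residue_norm_def by (rule to_ac_of_ac, rule prod_poly_proots_in_range_to_ac[OF assms])

lemma map_poly_to_ac_eq_0_iff [simp]: "map_poly to_ac p = 0 \<longleftrightarrow> p = 0"
  by (auto simp: poly_eq_iff coeff_map_poly)

lemma size_proots_map_poly_to_ac:
  assumes "lead_coeff g = 1"
  shows "size (proots (map_poly to_ac g)) = Polynomial.degree g"
proof -
  let ?A = "proots (map_poly to_ac g)"
  have "Polynomial.degree (\<Prod>x\<in>#A. [:-x, 1:]) = size A" for A :: "'a alg_closure multiset"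
  proof (induction A)
    case (add x A)
    have "(\<Prod>x\<in>#A. [:-x, 1:]) \<noteq> 0" by (auto simp: prod_mset_zero_iff)
    thus ?case using add by (simp add: degree_mult_eq del: mult_pCons_left)
  qed auto
  moreover have "map_poly to_ac g = (\<Prod>x\<in>#?A. [:-x, 1:])"
    by (rule monic_eq_prod_proots) (use assms in \<open>simp add: coeff_map_poly\<close>)
  ultimately show ?thesis by (metis degree_map_poly_to_ac)
qed

lemma residue_norm_mult_right:
  assumes "lead_coeff g = 1"
  shows "residue_norm g (a * b) = residue_norm g a * residue_norm g b"
proof -
  have "to_ac (residue_norm g (a * b)) = to_ac (residue_norm g a * residue_norm g b)"
    by (simp add: to_ac_residue_norm assms map_poly_to_ac_mult prod_mset.distrib)
  thus ?thesis by (simp only: to_ac_eq_iff)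
qed

lemma residue_norm_mult_left:
  assumes "lead_coeff g = 1" "lead_coeff h = 1"
  shows "residue_norm (g * h) a = residue_norm g a * residue_norm h a"
proof -
  have "lead_coeff (g * h) = 1" using assms by (simp add: lead_coeff_mult)
  moreover have "g \<noteq> 0" "h \<noteq> 0" using assms by auto
  ultimately have "to_ac (residue_norm (g * h) a) = to_ac (residue_norm g a * residue_norm h a)"
    by (simp add: to_ac_residue_norm assms map_poly_to_ac_mult proots_mult)
  thus ?thesis by (simp only: to_ac_eq_iff)
qed

lemma residue_norm_const:
  assumes "lead_coeff g = 1"
  shows "residue_norm g [:c:] = c ^ Polynomial.degree g"
proof -
  have "(\<Prod>y\<in>#A. poly (map_poly to_ac [:c:]) y) = to_ac c ^ size A" for A
    by (induction A) (auto simp: map_poly_pCons)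
  hence "to_ac (residue_norm g [:c:]) = to_ac (c ^ Polynomial.degree g)"
    by (simp add: to_ac_residue_norm assms size_proots_map_poly_to_ac)
  thus ?thesis by (simp only: to_ac_eq_iff)
qed

lemma residue_norm_1 [simp]: "lead_coeff g = 1 \<Longrightarrow> residue_norm g 1 = 1"
  using residue_norm_const[of g 1] by (simp add: one_pCons)

lemma residue_norm_smult:
  assumes "lead_coeff g = 1"
  shows "residue_norm g (Polynomial.smult c a) = c ^ Polynomial.degree g * residue_norm g a"
  using residue_norm_mult_right[OF assms, of "[:c:]" a] by (simp add: residue_norm_const assms)

lemma residue_norm_cong:
  assumes "lead_coeff g = 1" "g dvd a - b"
  shows "residue_norm g a = residue_norm g b"
proof -
  obtain c where "a - b = g * c" using assms(2) by (auto elim: dvdE)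
  hence a: "a = g * c + b" by (simp add: algebra_simps)
  have g0: "g \<noteq> 0" using assms by auto
  have "poly (map_poly to_ac a) y = poly (map_poly to_ac b) y" if "y \<in># proots (map_poly to_ac g)" for y
    using that g0 unfolding a by (simp add: map_poly_to_ac_add map_poly_to_ac_mult)
  hence "image_mset (poly (map_poly to_ac a)) (proots (map_poly to_ac g)) =
         image_mset (poly (map_poly to_ac b)) (proots (map_poly to_ac g))"
    by (intro image_mset_cong)
  thus ?thesis by (simp add: residue_norm_def)
qed

lemma residue_norm_eq_0_if_common_factor:
  assumes "P \<in> monic_polys d" "d > 0" "P dvd g" "P dvd a" "lead_coeff g = 1"
  shows "residue_norm g a = 0"
proof -
  obtain h where h: "g = P * h" using assms(3) by (auto elim: dvdE)
  have P: "lead_coeff P = 1" "Polynomial.degree P = d" using assms(1) by (auto simp: monic_polys_def)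
  hence "lead_coeff h = 1" using assms(5) h by (simp add: lead_coeff_mult)
  hence "residue_norm g a = residue_norm P a * residue_norm h a"
    using P h residue_norm_mult_left by blast
  also have "residue_norm P a = residue_norm P [:0:]"
    using assms(4) P by (intro residue_norm_cong) auto
  also have "\<dots> = 0" using residue_norm_const[OF P(1), of 0] P(2) assms(2) by simp
  finally show ?thesis by simp
qed

lemma residue_norm_eq_prod_diff:
  assumes "lead_coeff f = 1" "lead_coeff g = 1"
  shows "to_ac (residue_norm f g) =
           (\<Prod>x\<in>#proots (map_poly to_ac f). \<Prod>y\<in>#proots (map_poly to_ac g). x - y)"
  using assms poly_monic_eq_prod_proots[of "map_poly to_ac g"]
  by (simp add: to_ac_residue_norm coeff_map_poly)

lemma poly_resultant_eq_residue_norm: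
  assumes "lead_coeff f = 1" "lead_coeff g = 1"
  shows "poly_resultant f g = residue_norm f g"
  using to_ac_poly_resultant[OF assms] residue_norm_eq_prod_diff[OF assms] by (metis to_ac_eq_iff)

lemma residue_norm_swap:
  assumes "f \<in> monic_polys n" "g \<in> monic_polys m"
  shows "residue_norm f g = (-1) ^ (n * m) * residue_norm g f"
proof -
  have *: "lead_coeff f = 1" "lead_coeff g = 1" "Polynomial.degree f = n" "Polynomial.degree g = m"
    using assms by (auto simp: monic_polys_def)
  have "to_ac (residue_norm f g) = to_ac ((-1) ^ (n * m) * residue_norm g f)"
    unfolding to_ac_mult to_ac_power to_ac_minus to_ac_1
      residue_norm_eq_prod_diff[OF *(1,2)] residue_norm_eq_prod_diff[OF *(2,1)]
    by (subst prod_proots_swap) (simp only: size_proots_map_poly_to_ac[OF *(1)] size_proots_map_poly_to_ac[OF *(2)] *)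
  thus ?thesis by (simp only: to_ac_eq_iff)
qed

section \<open>Surjectivity of the norm of a finite field extension\<close>

lemma finite_field_power_card:
  fixes c :: "'a :: {finite, field}"
  shows "c ^ CARD('a) = c"
proof (cases "c = 0")
  case False
  let ?U = "UNIV - {0 :: 'a}"
  have "(\<Prod>y\<in>?U. y) = (\<Prod>y\<in>?U. c * y)"
    by (rule prod.reindex_bij_witness[of _ "\<lambda>y. c * y" "\<lambda>y. y / c"]) (use False in auto)
  also have "\<dots> = c ^ card ?U * (\<Prod>y\<in>?U. y)" by (simp add: prod.distrib)
  finally have "c ^ card ?U = 1" by simp
  hence "c * c ^ (CARD('a) - 1) = c" by (simp add: card_Diff_singleton)
  thus ?thesis using zero_less_card_finite[where 'a = 'a] by (metis Suc_pred' power_Suc)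
qed (simp add: power_0_left)

text \<open>
  Both sides are monic of degree \<open>q\<close>, so their difference has degree less than \<open>q\<close>, but it vanishes on
  the \<open>q\<close> elements of the base field.
\<close>
lemma frobenius_poly_eq_prod_linear:
  "Polynomial.monom 1 (CARD('a)) - Polynomial.monom 1 1 =
     (\<Prod>c\<in>(UNIV :: 'a :: {finite, field} set). [:- to_ac c, 1:])"
proof -
  let ?q = "CARD('a)"
  let ?L = "Polynomial.monom 1 ?q - Polynomial.monom 1 1 :: 'a alg_closure poly"
  let ?R = "(\<Prod>c\<in>(UNIV :: 'a set). [:- to_ac c, 1:])"
  have q: "?q > 1" by (rule card_finite_field_gt_1)
  show ?thesis
  proof (rule ccontr)
    assume "?L \<noteq> ?R"
    hence D: "?L - ?R \<noteq> 0" by simp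
    have degR: "Polynomial.degree ?R = ?q"
      by (subst degree_prod_eq_sum_degree) auto
    have lcR: "Polynomial.coeff ?R ?q = 1"
      using degR lead_coeff_prod[of "\<lambda>c. [:- to_ac c, 1:]" "UNIV :: 'a set"] by simp
    have "Polynomial.coeff (?L - ?R) i = 0" if "i \<ge> ?q" for i
      using that q degR lcR by (cases "i = ?q") (auto simp: coeff_eq_0)
    hence "?L - ?R \<in> polys_below ?q" by (auto simp: polys_below_def)
    hence deg: "Polynomial.degree (?L - ?R) < ?q" using D by (auto simp: polys_below_iff)
    have "to_ac ` (UNIV :: 'a set) \<subseteq> {x. poly (?L - ?R) x = 0}"
    proof safe
      fix c :: 'a
      have "poly ?R (to_ac c) = 0" by (simp add: poly_prod)
      moreover have "poly ?L (to_ac c) = 0"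
        using finite_field_power_card[of c] by (simp add: poly_monom flip: to_ac_power)
      ultimately show "poly (?L - ?R) (to_ac c) = 0" by simp
    qed
    hence "card (to_ac ` (UNIV :: 'a set)) \<le> card {x. poly (?L - ?R) x = 0}"
      using poly_roots_finite[OF D] by (intro card_mono)
    also have "\<dots> \<le> Polynomial.degree (?L - ?R)" using card_poly_roots_bound[OF D] .
    finally show False using deg by (simp add: card_image inj_to_ac)
  qed
qed

text \<open>
  This would follow from \<open>q\<close> being a power of the characteristic; the factorisation above gives it
  directly. The function \<open>L(x) = x\<^sup>q - x\<close> is the product of all \<open>x - c\<close>, hence invariant under translation
  by elements \<open>c\<close> of the base field. For fixed \<open>y\<close>, the polynomial \<open>L(x + y) - L(x) - L(y)\<close> therefore
  vanishes at all \<open>q\<close> elements of the base field, while its degree is less than \<open>q\<close>.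
\<close>
lemma frobenius_add:
  fixes x y :: "'a :: {finite, field} alg_closure"
  shows "(x + y) ^ CARD('a) = x ^ CARD('a) + y ^ CARD('a)"
proof -
  let ?q = "CARD('a)"
  define L where "L = (\<lambda>x :: 'a alg_closure. x ^ ?q - x)"
  have L: "L x = (\<Prod>c\<in>(UNIV :: 'a set). x - to_ac c)" for x
    using arg_cong[OF frobenius_poly_eq_prod_linear[where 'a = 'a], of "\<lambda>p. poly p x"]
    by (simp add: L_def poly_monom poly_prod)
  have shift: "L (to_ac c + y) = L y" for c y
    unfolding L
    by (rule prod.reindex_bij_witness[of _ "\<lambda>d. d + c" "\<lambda>d. d - c"]) (auto simp: algebra_simps)
  have L0: "L (to_ac c) = 0" for c using shift[of c 0] by (simp add: L_def power_0_left)
  define D where "D = [:y, 1:] ^ ?q - Polynomial.monom 1 ?q - [:y ^ ?q:]"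
  have pD: "poly D x = L (x + y) - L x - L y" for x
    by (simp add: D_def L_def poly_monom poly_power add.commute)
  have "D = 0"
  proof (rule ccontr)
    assume D: "D \<noteq> 0"
    have q: "?q > 1" by (rule card_finite_field_gt_1)
    have deg1: "Polynomial.degree ([:y, 1:] ^ ?q) = ?q" by (simp add: degree_power_eq)
    have lc1: "Polynomial.coeff ([:y, 1:] ^ ?q) ?q = 1"
      using deg1 lead_coeff_power[of "[:y, 1:]" ?q] by simp
    have "Polynomial.coeff D i = 0" if "i \<ge> ?q" for i
      using that q deg1 lc1
      by (cases "i = ?q") (auto simp: D_def coeff_eq_0 coeff_pCons split: nat.splits)
    hence "D \<in> polys_below ?q" by (auto simp: polys_below_def)
    hence deg: "Polynomial.degree D < ?q" using D by (auto simp: polys_below_iff)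
    have "to_ac ` (UNIV :: 'a set) \<subseteq> {x. poly D x = 0}"
      using shift L0 by (auto simp: pD)
    hence "card (to_ac ` (UNIV :: 'a set)) \<le> card {x. poly D x = 0}"
      using poly_roots_finite[OF D] by (intro card_mono)
    also have "\<dots> \<le> Polynomial.degree D" using card_poly_roots_bound[OF D] .
    finally show False using deg by (simp add: card_image inj_to_ac)
  qed
  hence "L (x + y) - L x - L y = 0" using pD[of x] by simp
  thus ?thesis by (simp add: L_def algebra_simps)
qed

lemma frobenius_poly:
  fixes p :: "'a :: {finite, field} poly" and x :: "'a alg_closure"
  shows "poly (map_poly to_ac p) (x ^ CARD('a)) = poly (map_poly to_ac p) x ^ CARD('a)"
proof (induction p)
  case (pCons c p)
  have "to_ac c ^ CARD('a) = to_ac c"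
    using finite_field_power_card[of c] by (metis to_ac_power)
  thus ?case using pCons by (simp add: map_poly_pCons frobenius_add power_mult_distrib)
qed (simp add: power_0_left)

lemma frobenius_poly_iter:
  fixes p :: "'a :: {finite, field} poly" and x :: "'a alg_closure"
  shows "poly (map_poly to_ac p) (x ^ (CARD('a) ^ i)) = poly (map_poly to_ac p) x ^ (CARD('a) ^ i)"
proof (induction i)
  case (Suc i)
  have "x ^ (CARD('a) ^ Suc i) = (x ^ (CARD('a) ^ i)) ^ CARD('a)"
    by (simp add: power_mult[symmetric] mult.commute)
  moreover have "poly (map_poly to_ac p) ((x ^ (CARD('a) ^ i)) ^ CARD('a)) =
      (poly (map_poly to_ac p) x ^ (CARD('a) ^ i)) ^ CARD('a)"
    unfolding frobenius_poly Suc ..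
  ultimately show ?case by (simp add: power_mult[symmetric] mult.commute)
qed auto

lemma frobenius_iter_inj:
  fixes x y :: "'a :: {finite, field} alg_closure"
  assumes "x ^ (CARD('a) ^ i) = y ^ (CARD('a) ^ i)"
  shows "x = y"
  using assms
proof (induction i)
  case (Suc i)
  let ?q = "CARD('a)"
  have inj1: "a = b" if "a ^ ?q = b ^ ?q" for a b :: "'a alg_closure"
  proof -
    have "a ^ ?q = (a - b) ^ ?q + b ^ ?q" using frobenius_add[of "a - b" b] by simp
    hence "(a - b) ^ ?q = 0" using that by simp
    thus ?thesis by simp
  qed
  have "(x ^ (?q ^ i)) ^ ?q = (y ^ (?q ^ i)) ^ ?q"
    using Suc.prems by (simp add: power_mult[symmetric] mult.commute)
  thus ?case using Suc.IH inj1 by blast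
qed auto

lemma card_power_roots_le:
  fixes c :: "'b :: idom"
  assumes "M > 0"
  shows "finite {y. y ^ M = c}" "card {y. y ^ M = c} \<le> M"
proof -
  let ?p = "Polynomial.monom 1 M - [:c:]"
  have "Polynomial.coeff ?p M = 1" using assms by (simp add: coeff_pCons split: nat.splits)
  hence p: "?p \<noteq> 0" by (metis coeff_0 zero_neq_one)
  have "Polynomial.degree ?p \<le> M"
    by (rule degree_diff_le) (auto simp: degree_monom_le)
  moreover have eq: "{y. poly ?p y = 0} = {y. y ^ M = c}" by (auto simp: poly_monom)
  ultimately show "finite {y. y ^ M = c}" "card {y. y ^ M = c} \<le> M"
    using poly_roots_finite[OF p] card_poly_roots_bound[OF p] by auto
qed

text \<open>
  The roots of \<open>P\<close> are the \<open>d\<close> conjugates of one root \<open>x\<close> under Frobenius, so \<open>N(w) = w(x)\<^sup>M\<close> with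
  \<open>M = 1 + q + \<dots> + q\<^bsup>d-1\<^esup>\<close>. Hence each value is taken by at most \<open>M\<close> residue classes. As there are
  \<open>q\<^sup>d - 1 = (q - 1) M\<close> nonzero classes, none of the \<open>q - 1\<close> nonzero values can be missed.
\<close>
lemma residue_norm_surj:
  fixes P :: "'a :: {finite, field} poly" and c :: 'a
  assumes irr: "irreducible P" and P: "P \<in> monic_polys d" and c: "c \<noteq> 0"
  shows "\<exists>w. residue_norm P w = c"
proof -
  define q where "q = CARD('a)"
  have q: "q > 1" unfolding q_def by (rule card_finite_field_gt_1)
  have lc: "lead_coeff P = 1" and deg: "Polynomial.degree P = d"
    using P by (auto simp: monic_polys_def)
  have P0: "P \<noteq> 0" "\<not> is_unit P" using irr by (auto simp: Factorial_Ring.irreducible_def)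
  have d: "d > 0" using degree_pos_if_not_unit[OF P0] deg by simp
  define R where "R = proots (map_poly to_ac P)"
  have sizeR: "size R = d" using size_proots_map_poly_to_ac[OF lc] deg by (simp add: R_def)
  have setR: "set_mset R = {y. poly (map_poly to_ac P) y = 0}" using P0 by (simp add: R_def)
  have "R \<noteq> {#}" using sizeR d by auto
  then obtain x where x: "x \<in># R" by (meson multiset_nonemptyE)
  define ev where "ev w = poly (map_poly to_ac w) x" for w :: "'a poly"
  have ev_P: "ev P = 0" using x setR by (simp add: ev_def)
  have ev_diff: "ev (a - b) = ev a - ev b" for a b
    using map_poly_to_ac_add[of "a - b" b] by (simp add: ev_def)
  have ev_0_dvd: "P dvd w" if "ev w = 0" for w
  proof (rule ccontr)
    assume "\<not> P dvd w"
    then obtain u v where "u * P + v * w = 1"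
      using coprime_poly_bezout[OF irreducible_poly_coprime[OF irr]] by metis
    hence "ev (u * P + v * w) = 1" by (simp add: ev_def)
    thus False using that ev_P by (simp add: ev_def map_poly_to_ac_add map_poly_to_ac_mult)
  qed
  have ev_0: "w = 0" if "ev w = 0" "w \<in> polys_below d" for w
    using ev_0_dvd[OF that(1)] that(2) dvd_imp_degree_le[of P w] deg
    unfolding polys_below_iff by linarith
  have inj_ev: "inj_on ev (polys_below d)"
    by (rule inj_onI) (metis ev_0 ev_diff polys_below_diff eq_iff_diff_eq_0)
  have card_V: "card (polys_below d :: 'a poly set) = q ^ d"
    using card_polys_below by (auto simp: q_def)
  have ev_frob: "poly (map_poly to_ac w) (x ^ (q ^ i)) = ev w ^ (q ^ i)" for w i
    unfolding ev_def q_def by (rule frobenius_poly_iter)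
  \<comment> \<open>The Frobenius orbit of \<open>x\<close> has length \<open>d\<close>: a shorter period would be a period of every element
    of the field generated by \<open>x\<close>, giving \<open>X ^ (q ^ k) - X\<close> too many roots.\<close>
  have period: False if k: "0 < k" "k < d" "x ^ (q ^ k) = x" for k
  proof -
    have "ev ` polys_below d \<subseteq> {y. poly (Polynomial.monom 1 (q ^ k) - Polynomial.monom 1 1) y = 0}"
      using ev_frob[of _ k] k(3) by (auto simp: poly_monom ev_def)
    moreover have qk: "q ^ k > 1" using q k(1) by (intro one_less_power)
    hence "Polynomial.coeff (Polynomial.monom 1 (q ^ k) - Polynomial.monom 1 1 :: 'a alg_closure poly) (q ^ k) = 1"
      by simp
    hence p: "(Polynomial.monom 1 (q ^ k) - Polynomial.monom 1 1 :: 'a alg_closure poly) \<noteq> 0"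
      by (metis coeff_0 zero_neq_one)
    ultimately have "card (ev ` polys_below d) \<le>
        Polynomial.degree (Polynomial.monom 1 (q ^ k) - Polynomial.monom 1 1 :: 'a alg_closure poly)"
      using card_mono[OF poly_roots_finite[OF p]] card_poly_roots_bound[OF p] le_trans by blast
    also have "\<dots> \<le> q ^ k" using qk
      by (intro degree_diff_le order_trans[OF degree_monom_le]) auto
    finally have "q ^ d \<le> q ^ k" by (simp add: card_image[OF inj_ev] card_V)
    thus False using power_strict_increasing[OF k(2) q] by simp
  qed
  have neq: "x ^ (q ^ i) \<noteq> x ^ (q ^ j)" if "i < j" "j < d" for i j
  proof
    assume "x ^ (q ^ i) = x ^ (q ^ j)"
    moreover have "q ^ j = q ^ (j - i) * q ^ i" using that by (simp flip: power_add)
    ultimately have "(x ^ (q ^ (j - i))) ^ (q ^ i) = x ^ (q ^ i)" by (simp add: power_mult)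
    hence "x ^ (q ^ (j - i)) = x" unfolding q_def by (rule frobenius_iter_inj)
    moreover have "0 < j - i" "j - i < d" using that by linarith+
    ultimately show False using period by blast
  qed
  have inj: "inj_on (\<lambda>i. x ^ (q ^ i)) {..<d}"
    by (intro inj_onI) (metis neq linorder_neqE_nat lessThan_iff)
  define A where "A = (\<lambda>i. x ^ (q ^ i)) ` {..<d}"
  have "A \<subseteq> set_mset R"
    unfolding A_def setR using ev_frob[of P] ev_P q by (auto simp: power_0_left)
  hence "mset_set A \<subseteq># R"
    by (metis A_def finite_imageI finite_lessThan finite_set_mset msubset_mset_set_iff
        mset_set_set_mset_msubset subset_mset.order_trans)
  moreover have "size (mset_set A) = size R"
    by (simp add: A_def card_image[OF inj] sizeR)
  ultimately have R: "R = mset_set A"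
    by (metis mset_subset_size nat_less_le subset_mset.le_less)
  define M where "M = (\<Sum>i<d. q ^ i)"
  have norm: "to_ac (residue_norm P w) = ev w ^ M" for w
  proof -
    have "to_ac (residue_norm P w) = (\<Prod>y\<in>A. poly (map_poly to_ac w) y)"
      by (simp add: to_ac_residue_norm[OF lc] R_def[symmetric] R prod_unfold_prod_mset)
    also have "\<dots> = (\<Prod>i<d. ev w ^ (q ^ i))"
      unfolding A_def by (subst prod.reindex[OF inj]) (simp add: ev_frob)
    finally show ?thesis by (simp add: M_def power_sum)
  qed
  have M: "M > 0" unfolding M_def using d q by (intro sum_pos) auto
  have qM: "(q - 1) * M = q ^ d - 1"
  proof -
    have "int ((q - 1) * M) = int (q ^ d - 1)"
      using q power_diff_1_eq[of "int q" d] by (simp add: M_def of_nat_diff)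
    thus ?thesis by (simp only: of_nat_eq_iff)
  qed
  define W where "W = polys_below d - {0 :: 'a poly}"
  define fib where "fib a = {w \<in> W. residue_norm P w = a}" for a
  have card_W: "card W = q ^ d - 1"
    by (simp add: W_def card_V card_Diff_singleton)
  have fib_le: "card (fib a) \<le> M" for a
  proof -
    have "card (fib a) = card (ev ` fib a)"
      by (intro card_image[symmetric] inj_on_subset[OF inj_ev]) (auto simp: fib_def W_def)
    also have "\<dots> \<le> card {y. y ^ M = to_ac a}"
      using card_power_roots_le(1)[OF M] by (intro card_mono) (auto simp: fib_def norm[symmetric])
    also have "\<dots> \<le> M" by (rule card_power_roots_le(2)[OF M])
    finally show ?thesis .
  qed
  show ?thesis
  proof (rule ccontr)
    assume none: "\<not> ?thesis"
    have "W = (\<Union>a\<in>UNIV - {0, c}. fib a)"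
    proof (intro equalityI subsetI)
      fix w assume w: "w \<in> W"
      have "ev w \<noteq> 0" using w ev_0 by (auto simp: W_def)
      hence "to_ac (residue_norm P w) \<noteq> 0" unfolding norm by simp
      thus "w \<in> (\<Union>a\<in>UNIV - {0, c}. fib a)" using w none by (auto simp: fib_def)
    qed (auto simp: fib_def)
    hence "card W \<le> (\<Sum>a\<in>UNIV - {0, c}. card (fib a))"
      by (metis card_UN_le finite)
    also have "\<dots> \<le> (\<Sum>a\<in>UNIV - {0, c}. M)" by (intro sum_mono fib_le)
    also have "\<dots> = (q - 2) * M" using c by (simp add: card_Diff_subset q_def numeral_2_eq_2)
    also have "\<dots> < (q - 1) * M" using M q by (intro mult_strict_right_mono) auto
    finally show False using card_W qM by simp
  qed
qed

section \<open>Multiplicative characters\<close>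

context
  fixes \<chi> :: "'a :: {finite, field} \<Rightarrow> complex"
  assumes chi: "mult_character \<chi>"
begin

lemma character_0: "\<chi> 0 = 0" using chi by (simp add: mult_character_def)

lemma character_mult: "\<chi> (x * y) = \<chi> x * \<chi> y"
  using chi by (cases "x = 0"; cases "y = 0") (auto simp: mult_character_def)

lemma character_1: "\<chi> 1 = 1"
  using character_mult[of 1 1] chi by (auto simp: mult_character_def)

lemma norm_character: "x \<noteq> 0 \<Longrightarrow> norm (\<chi> x) = 1"
proof -
  assume "x \<noteq> 0"
  hence "norm (\<chi> x) ^ (CARD('a) - 1) = 1"
    using mult_character_power_eq_1[OF chi] by (metis norm_one norm_power)
  moreover have "CARD('a) - 1 > 0" using card_finite_field_gt_1[where 'a = 'a] by simp
  ultimately show ?thesis by (metis norm_ge_zero power_eq_1_iff real_norm_def abs_norm_cancel gr_implies_not0)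
qed

lemma norm_character_le: "norm (\<chi> x) \<le> 1"
  by (cases "x = 0") (auto simp: norm_character character_0)

lemma character_power: "\<chi> (x ^ k) = \<chi> x ^ k"
  by (induction k) (auto simp: character_1 character_mult)

end

lemma mult_character_power:
  assumes "mult_character (\<chi> :: 'a :: {finite, field} \<Rightarrow> complex)" "k > 0"
  shows "mult_character (\<lambda>x. \<chi> x ^ k)"
  using assms by (auto simp: mult_character_def power_mult_distrib)

section \<open>A nontrivial additive character\<close>

text \<open>Nontriviality is normalised to \<open>\<psi> 1 \<noteq> 1\<close>, so that 1 can serve as the explicit witness.\<close>
definition additive_character :: "('a :: field \<Rightarrow> complex) \<Rightarrow> bool" where
  "additive_character \<psi> \<longleftrightarrow> (\<forall>x y. \<psi> (x + y) = \<psi> x * \<psi> y) \<and> (\<forall>x. norm (\<psi> x) = 1) \<and> \<psi> 1 \<noteq> 1"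

lemma prime_CHAR_finite_field: "prime CHAR('a :: {finite, field})"
  by (rule prime_CHAR_semidom) (rule finite_imp_CHAR_pos, simp)

lemma of_nat_inverse_mod_char:
  assumes "of_nat i \<noteq> (0 :: 'a :: {finite, field})"
  shows "\<exists>j. of_nat j * of_nat i = (1 :: 'a)"
proof -
  let ?p = "CHAR('a)"
  have p: "prime ?p" by (rule prime_CHAR_finite_field)
  have "\<not> ?p dvd i" using assms by (simp add: of_nat_eq_0_iff_char_dvd)
  hence "coprime i ?p" using p by (metis prime_imp_coprime coprime_commute)
  then obtain x y where "i * x = ?p * y + 1" by (metis bezout_nat coprime_imp_gcd_eq_1 gcd_1_nat assms of_nat_0)
  hence "(of_nat (i * x) :: 'a) = of_nat (?p * y + 1)" by simp
  hence "of_nat x * of_nat i = (1 :: 'a)" by (simp add: mult.commute)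
  thus ?thesis by blast
qed

text \<open>
  Let \<open>H\<close> be maximal among the additive subgroups that avoid 1. Maximality makes every element congruent
  modulo \<open>H\<close> to a multiple \<open>j \<sqdot> 1\<close>, where \<open>j\<close> is unique modulo the characteristic \<open>p\<close>; sending the element to
  the \<open>j\<close>-th power of a primitive \<open>p\<close>-th root of unity is the desired character.
\<close>
lemma additive_character_exists:
  "\<exists>\<psi> :: 'a :: {finite, field} \<Rightarrow> complex. additive_character \<psi>"
proof -
  let ?p = "CHAR('a)"
  have p: "prime ?p" by (rule prime_CHAR_finite_field)
  hence p1: "?p > 1" by (rule prime_gt_1_nat)
  define sub where "sub H \<longleftrightarrow> 0 \<in> H \<and> (\<forall>x\<in>H. \<forall>y\<in>H. x + y \<in> H)" for H :: "'a set"
  define S where "S = {H. sub H \<and> 1 \<notin> H}"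
  have "{0} \<in> S" by (auto simp: S_def sub_def)
  hence "Max (card ` S) \<in> card ` S" by (intro Max_in) auto
  then obtain H where H_max: "H \<in> S" "card H = Max (card ` S)" by auto
  hence H: "H \<in> S" "\<And>G. G \<in> S \<Longrightarrow> card G \<le> card H" by auto
  have H0: "0 \<in> H" and Hadd: "\<And>x y. x \<in> H \<Longrightarrow> y \<in> H \<Longrightarrow> x + y \<in> H" and H1: "1 \<notin> H"
    using H(1) by (auto simp: S_def sub_def)
  have Hmul: "of_nat k * x \<in> H" if "x \<in> H" for k x
    by (induction k) (use that H0 Hadd in \<open>auto simp: algebra_simps\<close>)
  have Hneg: "- x \<in> H" if "x \<in> H" for x
  proof -
    have "of_nat (?p - 1) = (- 1 :: 'a)" using p1 by (simp add: of_nat_diff)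
    thus ?thesis using Hmul[OF that, of "?p - 1"] by simp
  qed
  have decomp: "\<exists>j. x - of_nat j \<in> H" for x
  proof (cases "x \<in> H")
    case True
    thus ?thesis by (intro exI[of _ 0]) auto
  next
    case False
    \<comment> \<open>The subgroup generated by \<open>H\<close> and \<open>x\<close> must contain 1.\<close>
    define G where "G = {h + of_nat i * x | h i. h \<in> H}"
    have "sub G"
      unfolding sub_def G_def
    proof safe
      show "\<exists>h i. 0 = h + of_nat i * x \<and> h \<in> H" using H0 by (intro exI[of _ 0]) auto
    next
      fix h i h' i' assume "h \<in> H" "h' \<in> H"
      thus "\<exists>h'' i''. h + of_nat i * x + (h' + of_nat i' * x) = h'' + of_nat i'' * x \<and> h'' \<in> H"
        by (intro exI[of _ "h + h'"] exI[of _ "i + i'"]) (auto simp: algebra_simps Hadd)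
    qed
    moreover have "H \<subset> G"
    proof
      show "H \<subseteq> G" unfolding G_def by safe (metis add_0_right mult_zero_left of_nat_0)
      have "x \<in> G" unfolding G_def using H0 by safe (metis add_0_left mult_1 of_nat_1)
      thus "H \<noteq> G" using False by auto
    qed
    hence "card H < card G" by (intro psubset_card_mono) auto
    ultimately have "1 \<in> G" using H(2)[of G] by (auto simp: S_def)
    then obtain h i where hi: "1 = h + of_nat i * x" "h \<in> H" by (auto simp: G_def)
    have "of_nat i \<noteq> (0 :: 'a)" using hi H1 by auto
    then obtain j where j: "of_nat j * of_nat i = (1 :: 'a)" using of_nat_inverse_mod_char by blast
    have "of_nat j * (of_nat i * x) = x" by (simp add: j mult.assoc[symmetric])
    moreover have "of_nat i * x = 1 - h" using hi(1) by (simp add: algebra_simps)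
    ultimately have "x = of_nat j * (1 - h)" by metis
    hence "x = of_nat j - of_nat j * h" by (simp add: right_diff_distrib)
    hence "x - of_nat j = - (of_nat j * h)" by simp
    thus ?thesis using Hneg[OF Hmul[OF hi(2)]] by metis
  qed
  have uniq_le: "j mod ?p = i mod ?p" if "of_nat j - of_nat i \<in> H" "i \<le> j" for i j
  proof -
    have "of_nat (j - i) \<in> H" using that by (simp add: of_nat_diff)
    hence "of_nat (j - i) = (0 :: 'a)"
      using of_nat_inverse_mod_char[of "j - i", where 'a = 'a] Hmul H1 by metis
    hence "?p dvd j - i" by (simp add: of_nat_eq_0_iff_char_dvd)
    thus ?thesis using that(2) by (metis mod_eq_dvd_iff_nat)
  qed
  have uniq: "j mod ?p = i mod ?p" if "of_nat j - of_nat i \<in> H" for i j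
    using uniq_le[of j i] uniq_le[of i j] that Hneg[OF that] by (cases "i \<le> j") auto
  define ind where "ind x = (SOME j. x - of_nat j \<in> H)" for x
  have ind: "x - of_nat (ind x) \<in> H" for x
    unfolding ind_def by (rule someI_ex[OF decomp])
  have ind_eq: "ind x mod ?p = j mod ?p" if "x - of_nat j \<in> H" for x j
    using Hadd[OF that Hneg[OF ind[of x]]] by (intro uniq) (simp add: algebra_simps)
  define \<omega> where "\<omega> = cis (2 * pi / ?p)"
  define \<psi> where "\<psi> x = \<omega> ^ (ind x mod ?p)" for x
  have \<omega>p: "\<omega> ^ ?p = 1" using p1 by (simp add: \<omega>_def DeMoivre)
  have \<omega>mod: "\<omega> ^ (j mod ?p) = \<omega> ^ j" for j
  proof -
    have "\<omega> ^ j = \<omega> ^ (?p * (j div ?p) + j mod ?p)" by simp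
    also have "\<dots> = \<omega> ^ (j mod ?p)" unfolding power_add power_mult by (simp add: \<omega>p)
    finally show ?thesis by simp
  qed
  have "\<psi> (x + y) = \<psi> x * \<psi> y" for x y
  proof -
    have "(x + y) - of_nat (ind x + ind y) \<in> H"
      using Hadd[OF ind[of x] ind[of y]] by (simp add: algebra_simps)
    hence "ind (x + y) mod ?p = (ind x + ind y) mod ?p" by (rule ind_eq)
    hence "\<psi> (x + y) = \<omega> ^ ((ind x + ind y) mod ?p)" by (simp only: \<psi>_def)
    thus ?thesis by (simp only: \<omega>mod power_add \<psi>_def)
  qed
  moreover have "norm (\<psi> x) = 1" for x by (simp add: \<psi>_def \<omega>_def norm_power)
  moreover have "\<psi> 1 \<noteq> 1"
  proof -
    have "ind 1 mod ?p = 1 mod ?p" by (rule ind_eq) (simp add: H0)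
    hence "\<psi> 1 = \<omega>" using p1 by (simp add: \<psi>_def)
    moreover have "\<omega> \<noteq> 1"
    proof
      assume "\<omega> = 1"
      hence "cos (2 * pi / ?p) = 1" by (simp add: \<omega>_def complex_eq_iff)
      then obtain k :: int where k: "2 * pi / ?p = of_int k * 2 * pi"
        using cos_one_2pi_int by auto
      hence "2 * pi = (of_int k * 2 * pi) * real ?p" using p1 by (simp add: field_simps)
      hence "(2 * pi) * 1 = (2 * pi) * real_of_int (k * int ?p)" by (simp add: mult_ac)
      hence "1 = real_of_int (k * int ?p)" by (subst (asm) mult_left_cancel) auto
      hence "k * int ?p = 1" by linarith
      hence "int ?p dvd 1" by (metis dvd_triv_right)
      thus False using p1 by simp
    qed
    ultimately show ?thesis by simp
  qed
  ultimately show ?thesis unfolding additive_character_def by blast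
qed

section \<open>Squarefree decomposition\<close>

lemma monic_dvd_antisym:
  assumes "f \<in> monic_polys i" "g \<in> monic_polys j" "f dvd g" "g dvd f"
  shows "f = g"
proof -
  obtain h where h: "g = f * h" using assms(3) by (auto elim: dvdE)
  hence "lead_coeff h = 1" using assms by (auto simp: monic_polys_def lead_coeff_mult)
  moreover have "h dvd 1" using h assms(4) monic_polys_nonzero[OF assms(1)]
    by (metis dvd_mult_cancel_left mult.right_neutral)
  ultimately show ?thesis using is_unit_monic[of h "Polynomial.degree h"] h
    by (simp add: monic_polys_def)
qed

lemma monic_dvd_same_degree:
  assumes "f \<in> monic_polys i" "g \<in> monic_polys i" "f dvd g"
  shows "f = g"
proof -
  obtain h where h: "g = f * h" using assms(3) by (auto elim: dvdE)
  have "f \<noteq> 0" "g \<noteq> 0" using assms(1,2) by (auto dest: monic_polys_nonzero)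
  hence "Polynomial.degree h = 0" using h assms by (auto simp: monic_polys_def degree_mult_eq)
  moreover have "lead_coeff h = 1" using h assms by (auto simp: monic_polys_def lead_coeff_mult)
  ultimately have "h \<in> monic_polys 0" "is_unit h"
    using \<open>g \<noteq> 0\<close> h by (auto simp: monic_polys_def is_unit_iff_degree)
  hence "h = 1" by (rule is_unit_monic)
  thus ?thesis using h by simp
qed

lemma monic_factor:
  assumes "f \<in> monic_polys i" "f * h \<in> monic_polys k"
  shows "h \<in> monic_polys (k - i)" "i \<le> k"
proof -
  have "f \<noteq> 0" "f * h \<noteq> 0" using assms by (auto dest: monic_polys_nonzero)
  thus "h \<in> monic_polys (k - i)" "i \<le> k"
    using assms lead_coeff_mult[of f h] by (auto simp: monic_polys_def degree_mult_eq)
qed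

text \<open>
  Split off squares of nonunits until none is left.
\<close>
lemma square_decomposition_exists:
  assumes "f \<in> monic_polys k"
  shows "\<exists>j d s. 2 * j \<le> k \<and> d \<in> monic_polys j \<and> s \<in> monic_squarefree_polys (k - 2 * j) \<and> f = d ^ 2 * s"
  using assms
proof (induction k arbitrary: f rule: less_induct)
  case (less k)
  show ?case
  proof (cases "squarefree f")
    case True
    thus ?thesis using less.prems
      by (intro exI[of _ 0] exI[of _ 1] exI[of _ f])
         (auto simp: monic_squarefree_polys_def monic_polys_def)
  next
    case False
    then obtain x where x: "x ^ 2 dvd f" "\<not> x dvd 1" by (auto simp: squarefree_def)
    have "x \<noteq> 0" using x less.prems by (auto dest: monic_polys_nonzero)
    define i where "i = Polynomial.degree x"
    have i: "i > 0" using degree_pos_if_not_unit[OF \<open>x \<noteq> 0\<close> x(2)] by (simp add: i_def)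
    obtain y where y: "y \<in> monic_polys i" "y dvd x"
      using monic_scaling[OF \<open>x \<noteq> 0\<close>] unfolding i_def by metis
    have "y ^ 2 dvd f" using dvd_power_same[OF y(2)] x(1) dvd_trans by blast
    then obtain h where h: "f = y ^ 2 * h" by (auto elim: dvdE)
    have y2: "y ^ 2 \<in> monic_polys (2 * i)"
      using monic_polys_mult[OF y(1) y(1)] by (simp add: power2_eq_square mult_2)
    have hk: "h \<in> monic_polys (k - 2 * i)" "2 * i \<le> k"
      using monic_factor[OF y2, of h k] less.prems h by auto
    then obtain j d s where jds: "2 * j \<le> k - 2 * i" "d \<in> monic_polys j"
      "s \<in> monic_squarefree_polys (k - 2 * i - 2 * j)" "h = d ^ 2 * s"
      using less.IH[of "k - 2 * i" h] i by auto
    have "k - 2 * i - 2 * j = k - 2 * (i + j)" by simp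
    moreover have "y * d \<in> monic_polys (i + j)" using y(1) jds(2) by (rule monic_polys_mult)
    moreover have "f = (y * d) ^ 2 * s" using h jds(4) by (simp add: power_mult_distrib mult.assoc)
    moreover have "2 * (i + j) \<le> k" using hk jds by simp
    ultimately show ?thesis using jds(3) by metis
  qed
qed

text \<open>
  Write \<open>d1 = e a\<close> and \<open>d2 = e b\<close> with \<open>a\<close>, \<open>b\<close> coprime. Then \<open>a\<^sup>2\<close> divides \<open>b\<^sup>2 s2\<close>, hence \<open>s2\<close>, and so
  \<open>a\<close> is a unit. Applied in both directions, this gives the uniqueness of the square part.
\<close>
lemma square_part_root_dvd:
  fixes d1 d2 :: "'a :: field poly"
  assumes "d1 ^ 2 * s1 = d2 ^ 2 * s2" "squarefree s2" "d1 \<noteq> 0"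
  shows "d1 dvd d2"
proof -
  obtain e u v where e: "e = u * d1 + v * d2" "e dvd d1" "e dvd d2" using poly_bezout by blast
  obtain a b where ab: "d1 = e * a" "d2 = e * b" using e(2,3) unfolding dvd_def by blast
  have e0: "e \<noteq> 0" using ab assms(3) by auto
  have "e * (u * a + v * b) = e * 1" using e(1) unfolding ab by (simp add: algebra_simps)
  hence uv: "u * a + v * b = 1" using e0 by (metis mult_left_cancel)
  have "coprime (a ^ 2) (b ^ 2)"
    unfolding coprime_def
  proof safe
    fix c assume c: "c dvd a ^ 2" "c dvd b ^ 2"
    define x y where "x = u * a" and "y = v * b"
    have "x ^ 2 = a ^ 2 * u ^ 2" "y ^ 2 = b ^ 2 * v ^ 2"
      by (simp_all add: x_def y_def power_mult_distrib)
    hence xy: "c dvd x ^ 2" "c dvd y ^ 2" using c by (simp_all only: dvd_mult2)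
    \<comment> \<open>Each monomial of the cube of \<open>x + y = 1\<close> contains \<open>x\<^sup>2\<close> or \<open>y\<^sup>2\<close>.\<close>
    have "1 = (x + y) * (x + y) * (x + y)" using uv by (simp add: x_def y_def)
    also have "\<dots> = x ^ 2 * (x + y + y + y) + y ^ 2 * (x + x + x + y)"
      unfolding power2_eq_square by (simp only: distrib_left distrib_right ac_simps)
    also have "c dvd \<dots>" using xy by (intro dvd_add dvd_mult2)
    finally show "c dvd 1" .
  qed
  moreover have "e ^ 2 * (a ^ 2 * s1) = e ^ 2 * (b ^ 2 * s2)"
    using assms(1) unfolding ab by (simp add: power_mult_distrib mult.assoc)
  hence "a ^ 2 * s1 = b ^ 2 * s2" using e0 by simp
  hence "a ^ 2 dvd b ^ 2 * s2" by (metis dvd_triv_left)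
  ultimately have "a ^ 2 dvd s2" by (rule coprime_poly_dvd_mult)
  hence "a dvd 1" using assms(2) by (auto simp: squarefree_def)
  hence "e * a dvd e" by simp
  thus ?thesis using ab e(3) dvd_trans by blast
qed

lemma bij_betw_square_decomposition:
  "bij_betw (\<lambda>(j, d, s). d ^ 2 * s)
     (SIGMA j:{..k div 2}. monic_polys j \<times> monic_squarefree_polys (k - 2 * j))
     (monic_polys k :: 'a :: field poly set)"
proof (rule bij_betwI')
  fix x y
  assume x: "x \<in> (SIGMA j:{..k div 2}. (monic_polys j :: 'a poly set) \<times> (monic_squarefree_polys (k - 2 * j) :: 'a poly set))"
    and y: "y \<in> (SIGMA j:{..k div 2}. (monic_polys j :: 'a poly set) \<times> (monic_squarefree_polys (k - 2 * j) :: 'a poly set))"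
  obtain i d s where x': "x = (i, d, s)" "d \<in> monic_polys i" "s \<in> monic_squarefree_polys (k - 2 * i)"
    using x by auto
  obtain j e t where y': "y = (j, e, t)" "e \<in> monic_polys j" "t \<in> monic_squarefree_polys (k - 2 * j)"
    using y by auto
  have nz: "d \<noteq> 0" "e \<noteq> 0" using x' y' by (auto dest: monic_polys_nonzero)
  show "((case x of (j, d, s) \<Rightarrow> d ^ 2 * s) = (case y of (j, d, s) \<Rightarrow> d ^ 2 * s)) = (x = y)"
  proof
    assume "(case x of (j, d, s) \<Rightarrow> d ^ 2 * s) = (case y of (j, d, s) \<Rightarrow> d ^ 2 * s)"
    hence eq: "d ^ 2 * s = e ^ 2 * t" by (simp add: x' y')
    have "d dvd e"
      by (rule square_part_root_dvd[OF eq]) (use y' nz in \<open>auto simp: monic_squarefree_polys_def\<close>)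
    moreover have "e dvd d"
      by (rule square_part_root_dvd[OF eq[symmetric]]) (use x' nz in \<open>auto simp: monic_squarefree_polys_def\<close>)
    ultimately have "d = e" using monic_dvd_antisym x'(2) y'(2) by blast
    moreover have "s = t" using eq \<open>d = e\<close> nz by simp
    moreover have "i = j" using x'(2) y'(2) \<open>d = e\<close> by (auto simp: monic_polys_def)
    ultimately show "x = y" by (simp add: x' y')
  qed auto
next
  fix x assume x: "x \<in> (SIGMA j:{..k div 2}. (monic_polys j :: 'a poly set) \<times> (monic_squarefree_polys (k - 2 * j) :: 'a poly set))"
  obtain i d s where x': "x = (i, d, s)" "i \<le> k div 2" "d \<in> monic_polys i" "s \<in> monic_squarefree_polys (k - 2 * i)"
    using x by auto
  have "d * d * s \<in> monic_polys (i + i + (k - 2 * i))"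
    using x' monic_squarefree_polys_subset by (intro monic_polys_mult) auto
  moreover have "i + i + (k - 2 * i) = k" using x'(2) by linarith
  ultimately show "(case x of (j, d, s) \<Rightarrow> d ^ 2 * s) \<in> monic_polys k"
    by (simp add: x' power2_eq_square)
next
  fix f :: "'a poly" assume "f \<in> monic_polys k"
  then obtain j d s where "2 * j \<le> k" "d \<in> monic_polys j" "s \<in> monic_squarefree_polys (k - 2 * j)" "f = d ^ 2 * s"
    using square_decomposition_exists by blast
  thus "\<exists>x\<in>(SIGMA j:{..k div 2}. monic_polys j \<times> monic_squarefree_polys (k - 2 * j)). f = (case x of (j, d, s) \<Rightarrow> d ^ 2 * s)"
    by (intro bexI[of _ "(j, d, s)"]) auto
qed

section \<open>Units with prescribed norm\<close>

lemma invertible_if_residue_norm_nonzero: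
  assumes "lead_coeff g = 1" "residue_norm g u \<noteq> 0"
  shows "\<exists>v. g dvd v * u - 1"
proof -
  obtain e s t where e: "e = s * u + t * g" "e dvd u" "e dvd g" using poly_bezout by blast
  have "is_unit e"
  proof (rule ccontr)
    assume "\<not> is_unit e"
    then obtain P d where P: "irreducible P" "P \<in> monic_polys d" "d > 0" "P dvd e"
      by (rule irreducible_monic_factor_exists)
    hence "residue_norm g u = 0" using e assms(1)
      by (intro residue_norm_eq_0_if_common_factor[of P d]) (auto intro: dvd_trans)
    thus False using assms(2) by simp
  qed
  then obtain w where w: "1 = e * w" by (auto elim: dvdE)
  have "(s * w) * u - 1 = g * (- t * w)"
    unfolding w e(1) by (simp add: algebra_simps)
  thus ?thesis by (metis dvd_triv_left)
qed

text \<open>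
  By surjectivity of the norm and the Chinese remainder theorem. Such elements, trivial away from
  one prime \<open>P\<close> and with a chosen norm at \<open>P\<close>, are what makes characters visibly nontrivial.
\<close>
lemma unit_with_prescribed_norm:
  fixes P b :: "'a :: {finite, field} poly"
  assumes "irreducible P" "P \<in> monic_polys d" "\<not> P dvd b" "c \<noteq> 0"
  obtains u where "residue_norm P u = c" "b dvd u - 1"
proof -
  obtain w where w: "residue_norm P w = c" using residue_norm_surj assms(1,2,4) by blast
  obtain s t where st: "s * P + t * b = 1"
    using coprime_poly_bezout[OF irreducible_poly_coprime[OF assms(1,3)]] .
  define u where "u = 1 + (w - 1) * (t * b)"
  have "u - w = (1 - w) * (1 - t * b)" by (simp add: u_def algebra_simps)
  also have "1 - t * b = s * P" using st by (simp add: algebra_simps)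
  finally have "P dvd u - w" by (simp add: mult.assoc[symmetric])
  hence "residue_norm P u = residue_norm P w"
    using assms(2) by (intro residue_norm_cong) (auto simp: monic_polys_def)
  moreover have "b dvd u - 1" by (simp add: u_def)
  ultimately show ?thesis using that w by blast
qed

lemma squarefree_not_dvd_cofactor:
  assumes "squarefree (P * b)" "\<not> is_unit P" shows "\<not> P dvd b"
proof
  assume "P dvd b"
  hence "P ^ 2 dvd P * b" unfolding power2_eq_square by (intro mult_dvd_mono) auto
  thus False using assms by (auto simp: squarefree_def)
qed

section \<open>Bessel's inequality and sums over residues\<close>

text \<open>
  Orthogonality of the kernel in its second argument bounds the operator that it defines. This serves three
  times: for the mean square of \<open>sqfree_sum\<close>, for Gauss sums modulo \<open>g\<close> and for Gauss sums
  over the base field.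
\<close>
lemma bessel_inequality:
  fixes k :: "'x \<Rightarrow> 'y \<Rightarrow> complex"
  assumes "finite A" "finite B"
    and orth: "\<And>y z. y \<in> B \<Longrightarrow> z \<in> B \<Longrightarrow> y \<noteq> z \<Longrightarrow> (\<Sum>x\<in>A. k x y * cnj (k x z)) = 0"
    and diag: "\<And>y. y \<in> B \<Longrightarrow> (\<Sum>x\<in>A. norm (k x y) ^ 2) \<le> C"
  shows "(\<Sum>x\<in>A. norm (\<Sum>y\<in>B. f y * k x y) ^ 2) \<le> C * (\<Sum>y\<in>B. norm (f y) ^ 2)"
proof -
  have sq: "complex_of_real (norm z ^ 2) = z * cnj z" for z
    by (rule complex_norm_square)
  have "complex_of_real (\<Sum>x\<in>A. norm (\<Sum>y\<in>B. f y * k x y) ^ 2) =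
        (\<Sum>x\<in>A. \<Sum>y\<in>B. \<Sum>z\<in>B. (f y * cnj (f z)) * (k x y * cnj (k x z)))"
    unfolding of_real_sum sq cnj_sum sum_product by (simp add: algebra_simps)
  also have "\<dots> = (\<Sum>y\<in>B. \<Sum>z\<in>B. (f y * cnj (f z)) * (\<Sum>x\<in>A. k x y * cnj (k x z)))"
    unfolding sum_distrib_left
    by (subst sum.swap, rule sum.cong[OF refl], subst sum.swap, rule refl)
  also have "\<dots> = (\<Sum>y\<in>B. \<Sum>z\<in>B. if y = z then (f y * cnj (f y)) * (\<Sum>x\<in>A. k x y * cnj (k x y)) else 0)"
    using orth by (intro sum.cong) auto
  also have "\<dots> = (\<Sum>y\<in>B. (f y * cnj (f y)) * (\<Sum>x\<in>A. k x y * cnj (k x y)))"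
    using assms(2) by simp
  also have "\<dots> = complex_of_real (\<Sum>y\<in>B. norm (f y) ^ 2 * (\<Sum>x\<in>A. norm (k x y) ^ 2))"
    by (simp add: sq[symmetric])
  finally have "(\<Sum>x\<in>A. norm (\<Sum>y\<in>B. f y * k x y) ^ 2) =
      (\<Sum>y\<in>B. norm (f y) ^ 2 * (\<Sum>x\<in>A. norm (k x y) ^ 2))"
    by (simp only: of_real_eq_iff)
  also have "\<dots> \<le> (\<Sum>y\<in>B. norm (f y) ^ 2 * C)"
    using diag by (intro sum_mono mult_left_mono) auto
  finally show ?thesis by (simp add: sum_distrib_left mult.commute)
qed

text \<open>
  Multiplication by \<open>u\<close> permutes the residues modulo \<open>H\<close>, with inverse given by \<open>v\<close>. Invertibility of
  \<open>u\<close> is always expressed by such a \<open>v\<close>.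
\<close>
lemma mod_unit_mult_inverse:
  fixes H :: "'a :: field poly"
  assumes "H dvd v * u - 1"
  shows "(v * ((u * x) mod H)) mod H = x mod H"
proof -
  have "(v * ((u * x) mod H)) mod H = (v * (u * x)) mod H" by (simp add: mod_mult_right_eq)
  also have "H dvd v * (u * x) - x" using dvd_mult2[OF assms, of x] by (simp add: algebra_simps)
  hence "(v * (u * x)) mod H = x mod H" by (simp add: mod_eq_dvd_iff)
  finally show ?thesis .
qed

lemma mod_in_polys_below:
  assumes "H \<in> monic_polys D" shows "x mod H \<in> polys_below D"
  using degree_mod_less[OF monic_polys_nonzero[OF assms], of x] assms
  by (auto simp: polys_below_iff monic_polys_def)

lemma mod_polys_below:
  assumes "H \<in> monic_polys D" "x \<in> polys_below D" shows "x mod H = x"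
  using assms by (auto simp: polys_below_iff monic_polys_def mod_poly_less)

lemma sum_residues_unit_mult:
  fixes H :: "'a :: {finite, field} poly"
  assumes "H \<in> monic_polys D" "H dvd v * u - 1"
  shows "(\<Sum>x\<in>polys_below D. F ((u * x) mod H)) = (\<Sum>x\<in>polys_below D. F x)"
proof -
  have "H dvd u * v - 1" using assms(2) by (simp add: mult.commute)
  thus ?thesis
    by (intro sum.reindex_bij_witness[of _ "\<lambda>x. (v * x) mod H" "\<lambda>x. (u * x) mod H"])
       (simp_all add: mod_unit_mult_inverse[OF assms(2)] mod_unit_mult_inverse mod_in_polys_below[OF assms(1)] mod_polys_below[OF assms(1)])
qed

text \<open>
  Replacing the remainder of \<open>g\<close> modulo \<open>H\<close> by that of \<open>u g\<close> permutes the monic polynomials of degree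
  \<open>M \<ge> D\<close>, because only coefficients below \<open>D\<close> change. It multiplies the sum by \<open>F u \<noteq> 1\<close>.
\<close>
lemma sum_monic_polys_eq_0:
  fixes F :: "'a :: {finite, field} poly \<Rightarrow> complex"
  assumes H: "H \<in> monic_polys D" and D: "D \<le> M"
    and periodic: "\<And>a b. H dvd a - b \<Longrightarrow> F a = F b"
    and mult: "\<And>a. F (u * a) = F u * F a"
    and u: "H dvd v * u - 1" "F u \<noteq> 1"
  shows "(\<Sum>g\<in>monic_polys M. F g) = 0"
proof -
  have u': "H dvd u * v - 1" using u(1) by (simp add: mult.commute)
  define t where "t w g = g - g mod H + (w * g) mod H" for w g
  have t_monic: "t w g \<in> monic_polys M" if "g \<in> monic_polys M" for w g
  proof -
    have "t w g - Polynomial.monom 1 M = (g - Polynomial.monom 1 M) + ((w * g) mod H - g mod H)"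
      by (simp add: t_def)
    have "(w * g) mod H - g mod H \<in> polys_below D"
      using H by (intro polys_below_diff mod_in_polys_below)
    hence "(w * g) mod H - g mod H \<in> polys_below M" using D by (auto simp: polys_below_def)
    moreover note \<open>t w g - _ = _\<close>
    ultimately show ?thesis
      using that unfolding monic_poly_eq_monom_add by (simp only: polys_below_add)
  qed
  have t_mod: "t w g mod H = (w * g) mod H" for w g
  proof -
    have "g - g mod H = H * (g div H)" by (simp add: minus_mod_eq_mult_div)
    hence "t w g = H * (g div H) + (w * g) mod H" by (simp add: t_def)
    thus ?thesis by simp
  qed
  have t_inv: "t w (t z g) = g" if "H dvd w * z - 1" for w z g
  proof -
    have "(w * t z g) mod H = (w * (t z g mod H)) mod H" by (simp add: mod_mult_right_eq)
    also have "\<dots> = g mod H" unfolding t_mod using that by (rule mod_unit_mult_inverse)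
    finally have "t w (t z g) = t z g - (z * g) mod H + g mod H"
      by (subst t_def) (simp add: t_mod)
    thus ?thesis by (simp add: t_def)
  qed
  have "(\<Sum>g\<in>monic_polys M. F g) = (\<Sum>g\<in>monic_polys M. F (u * g))"
  proof (rule sum.reindex_bij_witness[of _ "t u" "t v"])
    fix g
    show "t u (t v g) = g" by (rule t_inv[OF u'])
    show "t v (t u g) = g" by (rule t_inv[OF u(1)])
    assume "g \<in> monic_polys M"
    thus "t u g \<in> monic_polys M" "t v g \<in> monic_polys M" by (rule t_monic)+
    have "(u * t v g) mod H = (u * (t v g mod H)) mod H" by (simp add: mod_mult_right_eq)
    also have "\<dots> = g mod H" unfolding t_mod using u' by (rule mod_unit_mult_inverse)
    finally have "H dvd u * t v g - g" by (simp add: mod_eq_dvd_iff)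
    thus "F (u * t v g) = F g" by (rule periodic)
  qed
  also have "\<dots> = F u * (\<Sum>g\<in>monic_polys M. F g)" by (simp add: mult sum_distrib_left)
  finally show ?thesis using u(2) by simp
qed

section \<open>Character sums modulo a polynomial\<close>

definition full_sum :: "('a :: {finite, field} \<Rightarrow> complex) \<Rightarrow> nat \<Rightarrow> 'a poly \<Rightarrow> complex" where
  "full_sum \<chi> k g = (\<Sum>h\<in>monic_polys k. \<chi> (residue_norm g h))"

definition sqfree_sum :: "('a :: {finite, field} \<Rightarrow> complex) \<Rightarrow> nat \<Rightarrow> 'a poly \<Rightarrow> complex" where
  "sqfree_sum \<chi> k g = (\<Sum>h\<in>monic_squarefree_polys k. \<chi> (residue_norm g h))"

lemma residue_norm_eq_1_if_dvd:
  assumes "lead_coeff g = 1" "g dvd u - 1"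
  shows "residue_norm g u = 1"
  using residue_norm_cong[OF assms] assms(1) by simp

text \<open>
  Primitivity of the character modulo a squarefree \<open>g\<close>: for each prime factor \<open>P\<close> it takes nontrivial
  values on classes that are 1 modulo the cofactor of \<open>P\<close>.
\<close>
lemma unit_at_one_factor:
  fixes g :: "'a :: {finite, field} poly"
  assumes g: "g \<in> monic_squarefree_polys m" and P: "irreducible P" "P \<in> monic_polys d" "P dvd g"
    and c: "c \<noteq> 0"
  obtains u b where "g = P * b" "b dvd u - 1" "residue_norm g u = c"
proof -
  obtain b where b: "g = P * b" using P(3) by (auto elim: dvdE)
  have gm: "P * b \<in> monic_polys m" using g b monic_squarefree_polys_subset by auto
  have "b \<in> monic_polys (m - d)" using monic_factor[OF P(2) gm] by simp
  hence lc: "lead_coeff P = 1" "lead_coeff b = 1" using P(2) by (auto simp: monic_polys_def)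
  have "\<not> is_unit P" using P(1) by (auto simp: Factorial_Ring.irreducible_def)
  hence "\<not> P dvd b" using squarefree_not_dvd_cofactor g b by (auto simp: monic_squarefree_polys_def)
  then obtain u where u: "residue_norm P u = c" "b dvd u - 1"
    using unit_with_prescribed_norm[OF P(1,2) _ c] by blast
  have "residue_norm g u = c"
    using u residue_norm_eq_1_if_dvd[OF lc(2) u(2)] by (simp add: b residue_norm_mult_left[OF lc])
  thus ?thesis using that b u by blast
qed

lemma monic_polys_lead: "g \<in> monic_polys m \<Longrightarrow> lead_coeff g = 1"
  by (auto simp: monic_polys_def)

lemma nontrivial_character_witness:
  assumes "nontrivial_character \<chi>"
  obtains c where "c \<noteq> 0" "\<chi> c \<noteq> 1"
  using assms by (auto simp: nontrivial_character_def)

lemma full_sum_eq_0: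
  fixes \<chi> :: "'a :: {finite, field} \<Rightarrow> complex"
  assumes chi: "mult_character \<chi>" and nt: "nontrivial_character \<chi>"
    and g: "g \<in> monic_squarefree_polys m" and m: "m > 0" "m \<le> k"
  shows "full_sum \<chi> k g = 0"
proof -
  have gm: "g \<in> monic_polys m" using g monic_squarefree_polys_subset by auto
  note lc = monic_polys_lead[OF gm]
  have "\<not> is_unit g" using gm m is_unit_iff_degree[OF monic_polys_nonzero[OF gm]] by (auto simp: monic_polys_def)
  then obtain P d where P: "irreducible P" "P \<in> monic_polys d" "P dvd g"
    using irreducible_monic_factor_exists by metis
  obtain c where c: "c \<noteq> 0" "\<chi> c \<noteq> 1" using nontrivial_character_witness[OF nt] .
  obtain u where u: "residue_norm g u = c" using unit_at_one_factor[OF g P c(1)] by blast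
  obtain v where v: "g dvd v * u - 1"
    using invertible_if_residue_norm_nonzero[OF lc] u c by blast
  show ?thesis
    unfolding full_sum_def
    by (rule sum_monic_polys_eq_0[OF gm m(2) _ _ v])
       (auto simp: residue_norm_cong[OF lc] residue_norm_mult_right[OF lc] character_mult[OF chi] u c)
qed

text \<open>
  By reciprocity the summand is, up to a sign that cancels, a character of \<open>g\<close> modulo \<open>s t\<close>, whose degree
  is at most \<open>m\<close>. Distinct squarefree \<open>s\<close>, \<open>t\<close> of the same degree differ at some prime \<open>P\<close> that divides
  exactly one of them, exactly once, and so the character is nontrivial at \<open>P\<close>.
\<close>
lemma sqfree_orthogonality:
  fixes \<chi> :: "'a :: {finite, field} \<Rightarrow> complex"
  assumes chi: "mult_character \<chi>" and nt: "nontrivial_character \<chi>"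
    and s: "s \<in> monic_squarefree_polys k" and t: "t \<in> monic_squarefree_polys k"
    and "s \<noteq> t" and km: "2 * k \<le> m"
  shows "(\<Sum>g\<in>monic_polys m. \<chi> (residue_norm g s) * cnj (\<chi> (residue_norm g t))) = 0"
proof -
  have sm: "s \<in> monic_polys k" and tm: "t \<in> monic_polys k"
    using s t monic_squarefree_polys_subset by auto
  note lcs = monic_polys_lead[OF sm] and lct = monic_polys_lead[OF tm]
  have s0: "s \<noteq> 0" using sm by (rule monic_polys_nonzero)
  obtain e x y where e: "e = x * s + y * t" "e dvd s" "e dvd t" using poly_bezout by blast
  obtain a where a: "s = e * a" using e(2) by (auto elim: dvdE)
  \<comment> \<open>The cofactor \<open>a\<close> of the greatest common divisor \<open>e\<close> in \<open>s\<close> supplies the prime \<open>P\<close>.\<close>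
  have "\<not> is_unit a"
  proof
    assume "is_unit a"
    hence "s dvd e" unfolding a by simp
    hence "s dvd t" using e(3) by (rule dvd_trans)
    thus False using monic_dvd_same_degree[OF sm tm] \<open>s \<noteq> t\<close> by simp
  qed
  then obtain P d where P: "irreducible P" "P \<in> monic_polys d" "P dvd a"
    using irreducible_monic_factor_exists by metis
  have Pu: "\<not> is_unit P" using P(1) by (auto simp: Factorial_Ring.irreducible_def)
  have Ps: "P dvd s" unfolding a using P(3) by simp
  then obtain b where b: "s = P * b" by (auto elim: dvdE)
  have Pb: "\<not> P dvd b"
    using squarefree_not_dvd_cofactor[OF _ Pu] s b by (auto simp: monic_squarefree_polys_def)
  have Pt: "\<not> P dvd t"
  proof
    assume "P dvd t"
    hence "P dvd e" unfolding e(1) using Ps by (intro dvd_add dvd_mult)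
    hence "P ^ 2 dvd s" unfolding a power2_eq_square using P(3) by (intro mult_dvd_mono)
    thus False using s Pu by (auto simp: monic_squarefree_polys_def squarefree_def)
  qed
  have Pbt: "\<not> P dvd b * t"
    using coprime_poly_dvd_mult[OF irreducible_poly_coprime[OF P(1) Pb]] Pt by blast
  obtain c where c: "c \<noteq> 0" "\<chi> c \<noteq> 1" using nontrivial_character_witness[OF nt] .
  obtain u where u: "residue_norm P u = c" "b * t dvd u - 1"
    using unit_with_prescribed_norm[OF P(1,2) Pbt c(1)] .
  have lcb: "lead_coeff b = 1" using monic_factor[OF P(2)] sm b by (metis monic_polys_lead)
  have "b dvd u - 1" "t dvd u - 1" using u(2) by (auto dest: dvd_mult_left dvd_mult_right)
  hence nb: "residue_norm b u = 1" and nt: "residue_norm t u = 1"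
    using residue_norm_eq_1_if_dvd lcb lct by blast+
  have ns: "residue_norm s u = c"
    using residue_norm_mult_left[OF monic_polys_lead[OF P(2)] lcb] b u nb by simp
  have H: "s * t \<in> monic_polys (k + k)" using sm tm by (rule monic_polys_mult)
  have "residue_norm (s * t) u = c" using ns nt residue_norm_mult_left[OF lcs lct] by simp
  then obtain v where v: "s * t dvd v * u - 1"
    using invertible_if_residue_norm_nonzero[OF monic_polys_lead[OF H]] c by blast
  define F where "F g = \<chi> (residue_norm s g) * cnj (\<chi> (residue_norm t g))" for g
  have "(\<Sum>g\<in>monic_polys m. F g) = 0"
  proof (rule sum_monic_polys_eq_0[OF H _ _ _ v])
    show "k + k \<le> m" using km by simp
    show "F u \<noteq> 1" using c by (simp add: F_def ns nt character_1[OF chi])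
    show "F (u * g) = F u * F g" for g
      by (simp add: F_def residue_norm_mult_right[OF lcs] residue_norm_mult_right[OF lct] character_mult[OF chi])
    fix g h assume "s * t dvd g - h"
    hence "s dvd g - h" "t dvd g - h" by (auto dest: dvd_mult_left dvd_mult_right)
    thus "F g = F h"
      using residue_norm_cong[OF lcs, of g h] residue_norm_cong[OF lct, of g h] by (simp add: F_def)
  qed
  moreover have "\<chi> (residue_norm g s) * cnj (\<chi> (residue_norm g t)) = F g" if "g \<in> monic_polys m" for g
  proof -
    let ?e = "\<chi> ((-1) ^ (m * k))"
    have "norm ?e = 1" by (rule norm_character[OF chi]) simp
    hence "?e * cnj ?e = 1" using complex_norm_square[of ?e] by simp
    moreover have "residue_norm g s = (-1) ^ (m * k) * residue_norm s g"
      "residue_norm g t = (-1) ^ (m * k) * residue_norm t g"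
      using residue_norm_swap[OF that sm] residue_norm_swap[OF that tm] by auto
    hence "\<chi> (residue_norm g s) * cnj (\<chi> (residue_norm g t)) = (?e * cnj ?e) * F g"
      by (simp add: character_mult[OF chi] F_def)
    ultimately show ?thesis by simp
  qed
  ultimately show ?thesis by simp
qed

lemma card_monic_squarefree_polys_le:
  "card (monic_squarefree_polys k :: 'a :: {finite, field} poly set) \<le> CARD('a) ^ k"
  using card_mono[OF finite_monic_polys monic_squarefree_polys_subset[where 'a = 'a]] card_monic_polys
  by metis

text \<open>
  Orthogonality needs the sum over all monic \<open>g\<close>, not only the squarefree ones; by positivity the
  sum may be enlarged to these.
\<close>
lemma sqfree_sum_mean_square:
  fixes \<chi> :: "'a :: {finite, field} \<Rightarrow> complex"
  assumes chi: "mult_character \<chi>" and nt: "nontrivial_character \<chi>" and km: "2 * k \<le> m"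
  shows "(\<Sum>g\<in>monic_squarefree_polys m. norm (sqfree_sum \<chi> k g) ^ 2) \<le> real (CARD('a)) ^ (m + k)"
proof -
  let ?B = "monic_squarefree_polys k :: 'a poly set"
  have "(\<Sum>g\<in>monic_squarefree_polys m. norm (sqfree_sum \<chi> k g) ^ 2) \<le>
      (\<Sum>g\<in>monic_polys m. norm (sqfree_sum \<chi> k g) ^ 2)"
    using monic_squarefree_polys_subset by (intro sum_mono2) auto
  also have "\<dots> = (\<Sum>g\<in>monic_polys m. norm (\<Sum>h\<in>?B. 1 * \<chi> (residue_norm g h)) ^ 2)"
    by (simp add: sqfree_sum_def)
  also have "\<dots> \<le> real (CARD('a)) ^ m * (\<Sum>h\<in>?B. norm (1 :: complex) ^ 2)"
  proof (rule bessel_inequality)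
    fix y z :: "'a poly" assume "y \<in> ?B" "z \<in> ?B" "y \<noteq> z"
    thus "(\<Sum>g\<in>monic_polys m. \<chi> (residue_norm g y) * cnj (\<chi> (residue_norm g z))) = 0"
      using sqfree_orthogonality[OF chi nt] km by blast
  next
    fix y :: "'a poly"
    have "(\<Sum>g\<in>monic_polys m. norm (\<chi> (residue_norm g y)) ^ 2) \<le> (\<Sum>g\<in>(monic_polys m :: 'a poly set). 1)"
      using norm_character_le[OF chi] by (intro sum_mono) (simp add: power_le_one)
    thus "(\<Sum>g\<in>monic_polys m. norm (\<chi> (residue_norm g y)) ^ 2) \<le> real (CARD('a)) ^ m"
      by (simp add: card_monic_polys)
  qed (auto simp: finite_monic_squarefree_polys)
  also have "\<dots> \<le> real (CARD('a)) ^ m * real (CARD('a)) ^ k"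
    using card_monic_squarefree_polys_le[of k, where 'a = 'a]
    by (intro mult_left_mono) (simp_all flip: of_nat_power)
  finally show ?thesis by (simp add: power_add)
qed

definition square_sum :: "('a :: {finite, field} \<Rightarrow> complex) \<Rightarrow> nat \<Rightarrow> 'a poly \<Rightarrow> complex" where
  "square_sum \<chi> j g = (\<Sum>d\<in>monic_polys j. \<chi> (residue_norm g d) ^ 2)"

lemma norm_square_sum_le:
  fixes \<chi> :: "'a :: {finite, field} \<Rightarrow> complex"
  assumes "mult_character \<chi>"
  shows "norm (square_sum \<chi> j g) \<le> real (CARD('a)) ^ j"
proof -
  have "norm (square_sum \<chi> j g) \<le> (\<Sum>d\<in>(monic_polys j :: 'a poly set). 1)"
    unfolding square_sum_def using norm_character_le[OF assms]
    by (intro sum_norm_le) (simp add: norm_power power_le_one)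
  thus ?thesis by (simp add: card_monic_polys)
qed

lemma full_sum_eq_sum_sqfree_sums:
  fixes \<chi> :: "'a :: {finite, field} \<Rightarrow> complex"
  assumes chi: "mult_character \<chi>" and lc: "lead_coeff g = 1"
  shows "full_sum \<chi> k g = (\<Sum>j\<le>k div 2. square_sum \<chi> j g * sqfree_sum \<chi> (k - 2 * j) g)"
proof -
  have fin: "finite ((monic_polys j :: 'a poly set) \<times> (monic_squarefree_polys (k - 2 * j) :: 'a poly set))" for j
    by (simp add: finite_monic_squarefree_polys)
  have "full_sum \<chi> k g =
      (\<Sum>(j, d, s)\<in>(SIGMA j:{..k div 2}. monic_polys j \<times> monic_squarefree_polys (k - 2 * j)).
          \<chi> (residue_norm g (d ^ 2 * s)))"
    unfolding full_sum_def
    by (subst sum.reindex_bij_betw[OF bij_betw_square_decomposition, symmetric])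
       (simp add: case_prod_unfold)
  also have "\<dots> = (\<Sum>j\<le>k div 2. \<Sum>(d, s)\<in>monic_polys j \<times> monic_squarefree_polys (k - 2 * j).
          \<chi> (residue_norm g (d ^ 2 * s)))"
    using fin by (subst sum.Sigma) auto
  also have "\<dots> = (\<Sum>j\<le>k div 2. square_sum \<chi> j g * sqfree_sum \<chi> (k - 2 * j) g)"
    by (simp add: square_sum_def sqfree_sum_def sum_product sum.cartesian_product
        power2_eq_square residue_norm_mult_right[OF lc] character_mult[OF chi])
  finally show ?thesis .
qed

section \<open>Fourier analysis modulo a polynomial\<close>

text \<open>
  An additive character modulo \<open>g\<close> such that \<open>(a, x) \<mapsto> residue_phase \<psi> g (a * x)\<close> is a perfect pairing on
  residues: \<open>\<psi>\<close> of the top coefficient of the remainder, which is the residue at infinity of \<open>z / g\<close>.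
\<close>
definition residue_phase :: "('a :: field \<Rightarrow> complex) \<Rightarrow> 'a poly \<Rightarrow> 'a poly \<Rightarrow> complex" where
  "residue_phase \<psi> g z = \<psi> (Polynomial.coeff (z mod g) (Polynomial.degree g - 1))"

lemma additive_character_0: 
  assumes "additive_character \<psi>" shows "\<psi> 0 = 1"
proof -
  have "\<psi> 0 * \<psi> 0 = \<psi> 0 * 1" using assms by (metis additive_character_def add_0 mult.right_neutral)
  moreover have "\<psi> 0 \<noteq> 0" using assms by (metis additive_character_def norm_zero zero_neq_one)
  ultimately show ?thesis by (metis mult_left_cancel)
qed

lemma residue_phase_add:
  assumes "additive_character \<psi>"
  shows "residue_phase \<psi> g (x + y) = residue_phase \<psi> g x * residue_phase \<psi> g y"
  using assms by (simp add: residue_phase_def additive_character_def poly_mod_add_left)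

lemma norm_residue_phase:
  assumes "additive_character \<psi>" shows "norm (residue_phase \<psi> g x) = 1"
  using assms by (simp add: residue_phase_def additive_character_def)

lemma residue_phase_mult_cnj:
  assumes "additive_character \<psi>"
  shows "residue_phase \<psi> g x * cnj (residue_phase \<psi> g y) = residue_phase \<psi> g (x - y)"
proof -
  have "residue_phase \<psi> g x = residue_phase \<psi> g (x - y) * residue_phase \<psi> g y"
    by (simp flip: residue_phase_add[OF assms])
  moreover have "residue_phase \<psi> g y * cnj (residue_phase \<psi> g y) = 1"
    using complex_norm_square[of "residue_phase \<psi> g y"] norm_residue_phase[OF assms, of g y] by simp
  ultimately show ?thesis by (simp add: mult.assoc)
qed

lemma residue_phase_cong: "g dvd x - y \<Longrightarrow> residue_phase \<psi> g x = residue_phase \<psi> g y"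
  unfolding residue_phase_def by (metis mod_eq_dvd_iff)

lemma residue_phase_small:
  assumes "g \<in> monic_polys m" "x \<in> polys_below m"
  shows "residue_phase \<psi> g x = \<psi> (Polynomial.coeff x (m - 1))"
  using assms mod_polys_below[OF assms] by (auto simp: residue_phase_def monic_polys_def)

lemma polys_below_mult:
  assumes "a \<in> polys_below i" "b \<in> polys_below j"
  shows "a * b \<in> polys_below (i + j - 1)"
proof (cases "a = 0 \<or> b = 0")
  case False
  thus ?thesis using assms by (auto simp: polys_below_iff degree_mult_eq)
qed auto

text \<open>
  Polynomials of degree below \<open>k\<close> and below \<open>m - k\<close> are exact annihilators of each other under the pairing.
  If the remainder \<open>r\<close> of \<open>z\<close> has degree \<open>i \<ge> m - k\<close>, the monomial \<open>b\<close> of degree \<open>m - 1 - i < k\<close>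
  moves the leading coefficient of \<open>r\<close> into the top position, and translation by \<open>b\<close> shows that the sum vanishes.
\<close>
lemma residue_phase_orthogonality:
  fixes g :: "'a :: {finite, field} poly"
  assumes psi: "additive_character \<psi>" and g: "g \<in> monic_polys m" and k: "k \<le> m" and m: "m > 0"
  shows "(\<Sum>a\<in>polys_below k. residue_phase \<psi> g (a * z)) =
           (if z mod g \<in> polys_below (m - k) then of_nat (CARD('a) ^ k) else 0)"
proof -
  define r where "r = z mod g"
  have red: "residue_phase \<psi> g (a * z) = residue_phase \<psi> g (a * r)" for a
    unfolding r_def residue_phase_def by (simp add: mod_mult_right_eq)
  have r: "r \<in> polys_below m" unfolding r_def by (rule mod_in_polys_below[OF g])
  show ?thesis
  proof (cases "r \<in> polys_below (m - k)")
    case True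
    have "residue_phase \<psi> g (a * r) = 1" if "a \<in> polys_below k" for a
    proof -
      have "a * r \<in> polys_below (m - 1)" using polys_below_mult[OF that True] k by simp
      moreover from this have "a * r \<in> polys_below m" by (auto simp: polys_below_def)
      ultimately show ?thesis
        using additive_character_0[OF psi] by (simp add: residue_phase_small[OF g]) (simp add: polys_below_def)
    qed
    hence "(\<Sum>a\<in>polys_below k. residue_phase \<psi> g (a * z)) = of_nat (card (polys_below k :: 'a poly set))"
      by (simp add: red)
    thus ?thesis using True card_polys_below[where k = k and 'a = 'a] by (simp add: r_def)
  next
    case False
    define i where "i = Polynomial.degree r"
    have r0: "r \<noteq> 0" and i: "m - k \<le> i" "i < m" using False r by (auto simp: polys_below_iff i_def)
    define b where "b = Polynomial.monom (inverse (lead_coeff r)) (m - 1 - i)"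
    have b: "b \<in> polys_below k" using i k m by (auto simp: b_def polys_below_def)
    have "Polynomial.degree (b * r) \<le> (m - 1 - i) + i"
      unfolding b_def i_def by (rule order_trans[OF degree_mult_le]) (simp add: degree_monom_le)
    hence "b * r \<in> polys_below m" using i by (auto simp: polys_below_iff)
    hence "residue_phase \<psi> g (b * r) = \<psi> (Polynomial.coeff (b * r) (m - 1))"
      by (rule residue_phase_small[OF g])
    also have "Polynomial.coeff (b * r) (m - 1) = 1"
      using i r0 by (simp add: b_def coeff_monom_mult i_def)
    finally have b1: "residue_phase \<psi> g (b * z) \<noteq> 1" using psi by (simp add: red additive_character_def)
    have "(\<Sum>a\<in>polys_below k. residue_phase \<psi> g (a * z)) =
          (\<Sum>a\<in>polys_below k. residue_phase \<psi> g ((b + a) * z))"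
      by (rule sum.reindex_bij_witness[of _ "\<lambda>a. b + a" "\<lambda>a. a - b"])
         (use b in \<open>auto intro: polys_below_add polys_below_diff\<close>)
    also have "\<dots> = residue_phase \<psi> g (b * z) * (\<Sum>a\<in>polys_below k. residue_phase \<psi> g (a * z))"
      by (simp add: distrib_right residue_phase_add[OF psi] sum_distrib_left)
    finally show ?thesis using b1 False by (simp add: r_def)
  qed
qed

definition gauss_sum :: "('a :: {finite, field} \<Rightarrow> complex) \<Rightarrow> ('a \<Rightarrow> complex) \<Rightarrow> 'a poly \<Rightarrow> 'a poly \<Rightarrow> complex" where
  "gauss_sum \<chi> \<psi> g a =
     (\<Sum>x\<in>polys_below (Polynomial.degree g). \<chi> (residue_norm g x) * residue_phase \<psi> g (a * x))"

text \<open>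
  For \<open>a\<close> prime to \<open>g\<close> this is the substitution \<open>x \<mapsto> x / a\<close>. If \<open>a\<close> shares a prime \<open>P\<close> with \<open>g\<close>, both sides
  vanish: there is a unit \<open>u\<close> that is 1 modulo \<open>g / P\<close> and has a norm at which \<open>\<chi>\<close> is not 1, and substituting
  \<open>u x\<close> for \<open>x\<close> leaves the phase unchanged. This is where primitivity enters.
\<close>
lemma gauss_sum_eq_cnj_character_mult:
  fixes \<chi> \<psi> :: "'a :: {finite, field} \<Rightarrow> complex"
  assumes chi: "mult_character \<chi>" and nt: "nontrivial_character \<chi>"
    and g: "g \<in> monic_squarefree_polys m"
  shows "gauss_sum \<chi> \<psi> g a = cnj (\<chi> (residue_norm g a)) * gauss_sum \<chi> \<psi> g 1"
proof -
  have gm: "g \<in> monic_polys m" using g monic_squarefree_polys_subset by auto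
  note lc = monic_polys_lead[OF gm]
  have deg: "Polynomial.degree g = m" using gm by (simp add: monic_polys_def)
  have twist: "gauss_sum \<chi> \<psi> g a = \<chi> (residue_norm g u) * gauss_sum \<chi> \<psi> g (a * u)"
    if v: "g dvd v * u - 1" for u v a
  proof -
    have "gauss_sum \<chi> \<psi> g a =
        (\<Sum>x\<in>polys_below m. \<chi> (residue_norm g ((u * x) mod g)) * residue_phase \<psi> g (a * ((u * x) mod g)))"
      unfolding gauss_sum_def deg by (rule sum_residues_unit_mult[OF gm v, symmetric])
    also have "\<dots> = (\<Sum>x\<in>polys_below m. \<chi> (residue_norm g u) * (\<chi> (residue_norm g x) * residue_phase \<psi> g (a * u * x)))"
    proof (rule sum.cong[OF refl])
      fix x
      have "residue_norm g ((u * x) mod g) = residue_norm g u * residue_norm g x"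
        unfolding residue_norm_mult_right[OF lc, symmetric]
        by (rule residue_norm_cong[OF lc]) (simp add: mod_eq_dvd_iff[symmetric])
      moreover have "residue_phase \<psi> g (a * ((u * x) mod g)) = residue_phase \<psi> g (a * u * x)"
        by (simp add: residue_phase_def mod_mult_right_eq mult.assoc)
      ultimately show "\<chi> (residue_norm g ((u * x) mod g)) * residue_phase \<psi> g (a * ((u * x) mod g)) =
          \<chi> (residue_norm g u) * (\<chi> (residue_norm g x) * residue_phase \<psi> g (a * u * x))"
        by (simp add: character_mult[OF chi])
    qed
    also have "\<dots> = \<chi> (residue_norm g u) * gauss_sum \<chi> \<psi> g (a * u)"
      unfolding gauss_sum_def deg by (simp add: sum_distrib_left)
    finally show ?thesis .
  qed
  have cong: "gauss_sum \<chi> \<psi> g a = gauss_sum \<chi> \<psi> g b" if "g dvd a - b" for a b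
  proof -
    have "g dvd a * x - b * x" for x using dvd_mult2[OF that, of x] by (simp add: algebra_simps)
    thus ?thesis unfolding gauss_sum_def using residue_phase_cong by (metis (mono_tags, lifting) sum.cong)
  qed
  show ?thesis
  proof (cases "residue_norm g a = 0")
    case False
    then obtain v where v: "g dvd v * a - 1"
      using invertible_if_residue_norm_nonzero[OF lc] by blast
    hence v': "g dvd a * v - 1" by (simp add: mult.commute)
    have "gauss_sum \<chi> \<psi> g a = \<chi> (residue_norm g v) * gauss_sum \<chi> \<psi> g 1"
      using twist[OF v', of a] cong[OF v'] by simp
    moreover have "residue_norm g v * residue_norm g a = 1"
      using residue_norm_eq_1_if_dvd[OF lc v] by (simp add: residue_norm_mult_right[OF lc])
    hence "\<chi> (residue_norm g v) * \<chi> (residue_norm g a) = 1"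
      by (metis character_mult[OF chi] character_1[OF chi])
    moreover have "\<chi> (residue_norm g a) * cnj (\<chi> (residue_norm g a)) = 1"
      using complex_norm_square[of "\<chi> (residue_norm g a)"] norm_character[OF chi False] by simp
    ultimately show ?thesis by (metis mult.assoc mult.commute mult.right_neutral)
  next
    case True
    have "\<not> coprime g a"
    proof
      assume "coprime g a"
      then obtain s t where "s * g + t * a = 1" by (rule coprime_poly_bezout)
      hence "t * a - 1 = g * (- s)" by (simp add: algebra_simps)
      hence "residue_norm g (t * a) = 1" by (intro residue_norm_eq_1_if_dvd[OF lc]) simp
      thus False using True by (simp add: residue_norm_mult_right[OF lc])
    qed
    then obtain e where e: "e dvd g" "e dvd a" "\<not> is_unit e" by (auto simp: coprime_def)
    then obtain P d where P: "irreducible P" "P \<in> monic_polys d" "P dvd e"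
      using irreducible_monic_factor_exists by metis
    have Pg: "P dvd g" and Pa: "P dvd a" using P(3) e dvd_trans by blast+
    obtain c where c: "c \<noteq> 0" "\<chi> c \<noteq> 1" using nontrivial_character_witness[OF nt] .
    obtain u b where u: "g = P * b" "b dvd u - 1" "residue_norm g u = c"
      using unit_at_one_factor[OF g P(1,2) Pg c(1)] .
    obtain v where v: "g dvd v * u - 1"
      using invertible_if_residue_norm_nonzero[OF lc] u c by blast
    have "g dvd a * (u - 1)" unfolding u(1) using Pa u(2) by (rule mult_dvd_mono)
    hence "g dvd a * u - a" by (simp add: algebra_simps)
    hence "gauss_sum \<chi> \<psi> g a = \<chi> c * gauss_sum \<chi> \<psi> g a"
      using twist[OF v, of a] cong[of "a * u" a] u(3) by simp
    hence "gauss_sum \<chi> \<psi> g a = 0" using c(2) by simp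
    thus ?thesis using True by (simp add: character_0[OF chi])
  qed
qed

text \<open>
  By the preceding lemma, the sum of the squared Gauss sums over all frequencies \<open>a\<close> is the square at frequency 1
  times the number of units; by Bessel's inequality it is at most \<open>q\<^sup>m\<close> times the number of units.
\<close>
lemma norm_gauss_sum_le:
  fixes \<chi> \<psi> :: "'a :: {finite, field} \<Rightarrow> complex"
  assumes chi: "mult_character \<chi>" and nt: "nontrivial_character \<chi>"
    and psi: "additive_character \<psi>"
    and g: "g \<in> monic_squarefree_polys m" and m: "m > 0"
  shows "norm (gauss_sum \<chi> \<psi> g 1) ^ 2 \<le> real (CARD('a)) ^ m"
proof -
  have gm: "g \<in> monic_polys m" using g monic_squarefree_polys_subset by auto
  note lc = monic_polys_lead[OF gm]
  have deg: "Polynomial.degree g = m" using gm by (simp add: monic_polys_def)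
  let ?B = "polys_below m :: 'a poly set"
  define S where "S = (\<Sum>a\<in>?B. norm (\<chi> (residue_norm g a)) ^ 2)"
  have card: "card ?B = CARD('a) ^ m" using card_polys_below by auto
  have "norm (gauss_sum \<chi> \<psi> g 1) ^ 2 * S = (\<Sum>a\<in>?B. norm (gauss_sum \<chi> \<psi> g a) ^ 2)"
    unfolding S_def sum_distrib_left
    by (intro sum.cong refl, subst (2) gauss_sum_eq_cnj_character_mult[OF chi nt g]) (simp add: norm_mult power_mult_distrib)
  also have "\<dots> = (\<Sum>a\<in>?B. norm (\<Sum>x\<in>?B. \<chi> (residue_norm g x) * residue_phase \<psi> g (a * x)) ^ 2)"
    by (simp add: gauss_sum_def deg)
  also have "\<dots> \<le> real (CARD('a)) ^ m * S"
    unfolding S_def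
  proof (rule bessel_inequality)
    fix x y :: "'a poly" assume xy: "x \<in> ?B" "y \<in> ?B" "x \<noteq> y"
    have "x - y \<in> ?B" using xy by (intro polys_below_diff)
    hence "(x - y) mod g = x - y" by (rule mod_polys_below[OF gm])
    moreover have "(\<Sum>a\<in>?B. residue_phase \<psi> g (a * x) * cnj (residue_phase \<psi> g (a * y))) =
          (\<Sum>a\<in>?B. residue_phase \<psi> g (a * (x - y)))"
      by (simp add: residue_phase_mult_cnj[OF psi] algebra_simps)
    ultimately show "(\<Sum>a\<in>?B. residue_phase \<psi> g (a * x) * cnj (residue_phase \<psi> g (a * y))) = 0"
      using residue_phase_orthogonality[OF psi gm order_refl m, of "x - y"] xy(3) by simp
  next
    fix y :: "'a poly"
    show "(\<Sum>a\<in>?B. norm (residue_phase \<psi> g (a * y)) ^ 2) \<le> real (CARD('a)) ^ m"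
      by (simp add: norm_residue_phase[OF psi] card)
  qed auto
  finally have "norm (gauss_sum \<chi> \<psi> g 1) ^ 2 * S \<le> real (CARD('a)) ^ m * S" .
  moreover have "S > 0"
  proof -
    have "norm (\<chi> (residue_norm g 1)) ^ 2 \<le> S"
      unfolding S_def using m by (intro member_le_sum) (auto simp: polys_below_iff)
    thus ?thesis using lc by (simp add: character_1[OF chi])
  qed
  ultimately show ?thesis by simp
qed

text \<open>
  Poisson summation. Sum \<open>gauss_sum \<chi> \<psi> g a\<close> against the phase of \<open>- a t\<^sup>k\<close> over \<open>a\<close> of degree below
  \<open>m - k\<close>. By orthogonality only those \<open>x\<close> remain for which \<open>x - t\<^sup>k\<close> has degree below \<open>k\<close>, that
  is, the monic polynomials of degree \<open>k\<close>. The dual sum runs over polynomials that need not be monic.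
\<close>
lemma functional_equation:
  fixes \<chi> \<psi> :: "'a :: {finite, field} \<Rightarrow> complex"
  assumes chi: "mult_character \<chi>" and nt: "nontrivial_character \<chi>"
    and psi: "additive_character \<psi>"
    and g: "g \<in> monic_squarefree_polys m" and k: "k < m"
  shows "of_nat (CARD('a) ^ (m - k)) * full_sum \<chi> k g =
     gauss_sum \<chi> \<psi> g 1 *
       cnj (\<Sum>a\<in>polys_below (m - k). \<chi> (residue_norm g a) * \<psi> (Polynomial.coeff a (m - k - 1)))"
proof -
  have gm: "g \<in> monic_polys m" using g monic_squarefree_polys_subset by auto
  have deg: "Polynomial.degree g = m" using gm by (simp add: monic_polys_def)
  let ?B = "polys_below m :: 'a poly set" and ?V = "polys_below (m - k) :: 'a poly set"
  let ?t = "Polynomial.monom 1 k :: 'a poly"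
  have t: "?t \<in> ?B" using k by (auto simp: polys_below_def)
  have phase: "residue_phase \<psi> g (a * ?t) = \<psi> (Polynomial.coeff a (m - k - 1))" if a: "a \<in> ?V" for a
  proof -
    have "a * ?t \<in> ?B" using a unfolding polys_below_def by (auto simp: mult.commute[of a] coeff_monom_mult)
    moreover have "Polynomial.coeff (a * ?t) (m - 1) = Polynomial.coeff a (m - k - 1)"
      using k by (auto simp: mult.commute[of a] coeff_monom_mult diff_right_commute)
    ultimately show ?thesis by (simp add: residue_phase_small[OF gm])
  qed
  have "gauss_sum \<chi> \<psi> g 1 *
       cnj (\<Sum>a\<in>?V. \<chi> (residue_norm g a) * \<psi> (Polynomial.coeff a (m - k - 1))) =
     (\<Sum>a\<in>?V. gauss_sum \<chi> \<psi> g a * cnj (residue_phase \<psi> g (a * ?t)))"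
    unfolding cnj_sum sum_distrib_left
    by (intro sum.cong refl, subst (2) gauss_sum_eq_cnj_character_mult[OF chi nt g]) (simp add: phase)
  also have "\<dots> = (\<Sum>a\<in>?V. \<Sum>x\<in>?B. \<chi> (residue_norm g x) *
        (residue_phase \<psi> g (a * x) * cnj (residue_phase \<psi> g (a * ?t))))"
    by (simp add: gauss_sum_def deg sum_distrib_right mult.assoc)
  also have "\<dots> = (\<Sum>x\<in>?B. \<chi> (residue_norm g x) * (\<Sum>a\<in>?V. residue_phase \<psi> g (a * (x - ?t))))"
    unfolding sum_distrib_left residue_phase_mult_cnj[OF psi] right_diff_distrib[symmetric]
    by (rule sum.swap)
  also have "\<dots> = (\<Sum>x\<in>?B. if x \<in> monic_polys k then \<chi> (residue_norm g x) * of_nat (CARD('a) ^ (m - k)) else 0)"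
  proof (rule sum.cong[OF refl])
    fix x assume x: "x \<in> ?B"
    have mm: "(x - ?t) mod g = x - ?t" using x t by (intro mod_polys_below[OF gm] polys_below_diff)
    have "(\<Sum>a\<in>?V. residue_phase \<psi> g (a * (x - ?t))) =
        (if x - ?t \<in> polys_below k then of_nat (CARD('a) ^ (m - k)) else 0)"
      using residue_phase_orthogonality[OF psi gm, of "m - k" "x - ?t"] k unfolding mm by simp
    thus "\<chi> (residue_norm g x) * (\<Sum>a\<in>?V. residue_phase \<psi> g (a * (x - ?t))) =
        (if x \<in> monic_polys k then \<chi> (residue_norm g x) * of_nat (CARD('a) ^ (m - k)) else 0)"
      by (simp add: monic_poly_eq_monom_add)
  qed
  also have "\<dots> = (\<Sum>x\<in>?B \<inter> monic_polys k. \<chi> (residue_norm g x) * of_nat (CARD('a) ^ (m - k)))"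
    by (rule sum.inter_restrict[symmetric]) simp
  also have "?B \<inter> monic_polys k = monic_polys k"
    using k by (auto simp: monic_polys_def polys_below_iff)
  finally show ?thesis by (simp add: full_sum_def sum_distrib_left mult.commute)
qed

section \<open>Bounding the dual sum\<close>

text \<open>
  The argument is the same as modulo \<open>g\<close>, but \<open>\<eta>\<close> may be trivial. Therefore only the frequencies
  \<open>b \<noteq> 0\<close> are used, for which the substitution \<open>c \<mapsto> b c\<close> is available.
\<close>
lemma norm_field_gauss_sum_le:
  fixes \<eta> \<psi> :: "'a :: {finite, field} \<Rightarrow> complex"
  assumes eta: "mult_character \<eta>" and psi: "additive_character \<psi>"
  shows "norm (\<Sum>c\<in>UNIV. \<eta> c * \<psi> c) \<le> sqrt (real (CARD('a)))"
proof -
  let ?q = "real (CARD('a))"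
  define G where "G b = (\<Sum>c\<in>UNIV. \<eta> c * \<psi> (b * c))" for b
  have psi_cnj: "\<psi> x * cnj (\<psi> y) = \<psi> (x - y)" for x y
  proof -
    have "\<psi> x = \<psi> (x - y) * \<psi> y" using psi by (metis additive_character_def diff_add_cancel)
    moreover have "\<psi> y * cnj (\<psi> y) = 1"
      using complex_norm_square[of "\<psi> y"] psi by (simp add: additive_character_def)
    ultimately show ?thesis by (simp add: mult.assoc)
  qed
  have card1: "card (UNIV - {0 :: 'a}) = CARD('a) - 1" by (simp add: card_Diff_singleton)
  have G: "norm (G b) = norm (G 1)" if "b \<noteq> 0" for b
  proof -
    have "G 1 = (\<Sum>c\<in>UNIV. \<eta> (b * c) * \<psi> (b * c))"
      unfolding G_def by (rule sum.reindex_bij_witness[of _ "\<lambda>c. b * c" "\<lambda>c. c / b"]) (use that in auto)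
    also have "\<dots> = \<eta> b * G b" by (simp add: G_def character_mult[OF eta] sum_distrib_left mult.assoc)
    finally show ?thesis by (simp add: norm_mult norm_character[OF eta that])
  qed
  have "(\<Sum>b\<in>UNIV - {0 :: 'a}. norm (G b) ^ 2) = (\<Sum>b\<in>UNIV - {0 :: 'a}. norm (G 1) ^ 2)"
    by (intro sum.cong refl) (metis G DiffD2 singletonI)
  hence "(?q - 1) * norm (G 1) ^ 2 = (\<Sum>b\<in>UNIV - {0 :: 'a}. norm (G b) ^ 2)"
    using card_finite_field_gt_1[where 'a = 'a] by (simp add: card1 of_nat_diff)
  also have "\<dots> \<le> (\<Sum>b\<in>UNIV. norm (G b) ^ 2)" by (intro sum_mono2) auto
  also have "\<dots> \<le> ?q * (\<Sum>c\<in>(UNIV :: 'a set). norm (\<eta> c) ^ 2)"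
    unfolding G_def
  proof (rule bessel_inequality)
    fix y z :: 'a assume "y \<noteq> z"
    define w where "w = y - z"
    have w: "w \<noteq> 0" using \<open>y \<noteq> z\<close> by (simp add: w_def)
    have "(\<Sum>b\<in>UNIV. \<psi> (b * w)) = (\<Sum>b\<in>UNIV. \<psi> ((b + inverse w) * w))"
      by (rule sum.reindex_bij_witness[of _ "\<lambda>b. b + inverse w" "\<lambda>b. b - inverse w"]) auto
    also have "\<dots> = (\<Sum>b\<in>UNIV. \<psi> (b * w)) * \<psi> 1"
      using w psi by (simp add: distrib_right additive_character_def sum_distrib_right)
    finally have "(\<Sum>b\<in>UNIV. \<psi> (b * w)) = 0" using psi by (simp add: additive_character_def)
    thus "(\<Sum>b\<in>UNIV. \<psi> (b * y) * cnj (\<psi> (b * z))) = 0"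
      by (simp add: psi_cnj w_def right_diff_distrib)
  next
    fix y :: 'a
    show "(\<Sum>b\<in>(UNIV :: 'a set). norm (\<psi> (b * y)) ^ 2) \<le> ?q"
      using psi by (simp add: additive_character_def)
  qed auto
  also have "(\<Sum>c\<in>(UNIV :: 'a set). norm (\<eta> c) ^ 2) = (\<Sum>c\<in>UNIV - {0 :: 'a}. norm (\<eta> c) ^ 2)"
    by (rule sum.mono_neutral_right) (auto simp: character_0[OF eta])
  also have "\<dots> = ?q - 1"
    using card_finite_field_gt_1[where 'a = 'a] by (simp add: norm_character[OF eta] card1 of_nat_diff)
  finally have "(?q - 1) * norm (G 1) ^ 2 \<le> (?q - 1) * ?q" by (simp add: mult.commute)
  hence "norm (G 1) ^ 2 \<le> ?q"
    using card_finite_field_gt_1[where 'a = 'a] by simp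
  hence "norm (G 1) \<le> sqrt ?q" by (rule real_le_rsqrt)
  thus ?thesis by (simp add: G_def)
qed

text \<open>
  A polynomial of degree exactly \<open>j\<close> is a nonzero constant times a monic one.
\<close>
lemma sum_polys_below_Suc:
  fixes F :: "'a :: {finite, field} poly \<Rightarrow> complex"
  shows "(\<Sum>a\<in>polys_below (Suc j). F a) =
     (\<Sum>a\<in>polys_below j. F a) + (\<Sum>c\<in>UNIV - {0}. \<Sum>h\<in>monic_polys j. F (Polynomial.smult c h))"
proof -
  define D where "D = {a :: 'a poly. a \<noteq> 0 \<and> Polynomial.degree a = j}"
  have sub: "(polys_below j :: 'a poly set) \<subseteq> polys_below (Suc j)" by (auto simp: polys_below_def)
  have D: "polys_below (Suc j) - polys_below j = D" by (auto simp: polys_below_iff D_def)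
  have "(\<Sum>c\<in>UNIV - {0}. \<Sum>h\<in>monic_polys j. F (Polynomial.smult c h)) =
        (\<Sum>(c, h)\<in>(UNIV - {0}) \<times> monic_polys j. F (Polynomial.smult c h))"
    by (simp add: sum.cartesian_product)
  also have "\<dots> = (\<Sum>a\<in>D. F a)"
    by (rule sum.reindex_bij_witness[of _ "\<lambda>a. (lead_coeff a, Polynomial.smult (inverse (lead_coeff a)) a)"
          "\<lambda>(c, h). Polynomial.smult c h"])
       (auto simp: D_def monic_polys_def)
  finally show ?thesis
    using sum.subset_diff[OF sub, of F] unfolding D by (simp add: add.commute)
qed

lemma norm_sum_polys_below_le:
  fixes \<chi> :: "'a :: {finite, field} \<Rightarrow> complex"
  assumes chi: "mult_character \<chi>" and g: "g \<in> monic_polys m" and m: "m > 0"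
  shows "norm (\<Sum>a\<in>polys_below j. \<chi> (residue_norm g a)) \<le>
           real (CARD('a)) * (\<Sum>i<j. norm (full_sum \<chi> i g))"
proof (induction j)
  case 0
  have "residue_norm g 0 = 0"
    using residue_norm_const[of g 0] g m by (auto simp: monic_polys_def)
  thus ?case by (simp add: character_0[OF chi])
next
  case (Suc j)
  have "(\<Sum>c\<in>UNIV - {0}. \<Sum>h\<in>monic_polys j. \<chi> (residue_norm g (Polynomial.smult c h))) =
        (\<Sum>c\<in>UNIV - {0}. \<chi> c ^ m) * full_sum \<chi> j g"
    using g by (auto simp: residue_norm_smult character_mult[OF chi] character_power[OF chi]
        monic_polys_def full_sum_def sum_product)
  moreover have "norm (\<Sum>c\<in>UNIV - {0}. \<chi> c ^ m) \<le> (\<Sum>c\<in>UNIV - {0 :: 'a}. 1)"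
    by (intro sum_norm_le) (simp add: norm_power norm_character[OF chi])
  hence "norm (\<Sum>c\<in>UNIV - {0}. \<chi> c ^ m) \<le> real (CARD('a))"
    by (simp add: card_Diff_singleton)
  ultimately have "norm (\<Sum>c\<in>UNIV - {0}. \<Sum>h\<in>monic_polys j. \<chi> (residue_norm g (Polynomial.smult c h)))
      \<le> real (CARD('a)) * norm (full_sum \<chi> j g)"
    by (simp add: norm_mult mult_right_mono)
  thus ?case unfolding sum_polys_below_Suc
    using norm_triangle_mono[OF Suc] by (simp add: distrib_left)
qed

text \<open>
  Grouping the dual sum by leading coefficients \<open>c\<close> produces \<open>\<Sum> \<chi>(c)\<^sup>m \<psi>(c)\<close> in the top degree \<open>j\<close>, a Gauss sum of
  size at most \<open>\<surd>q\<close>. In lower degrees \<open>\<psi>\<close> is absent and the sum over \<open>c\<close> is bounded trivially by \<open>q\<close>; this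
  full factor \<open>\<surd>q\<close> more is harmless, because \<open>full_sum\<close> has square root size and the degree is smaller by at
  least 1.
\<close>
lemma norm_dual_sum_le:
  fixes \<chi> \<psi> :: "'a :: {finite, field} \<Rightarrow> complex"
  assumes chi: "mult_character \<chi>" and psi: "additive_character \<psi>"
    and g: "g \<in> monic_polys m" and m: "m > 0"
  shows "norm (\<Sum>a\<in>polys_below (Suc j). \<chi> (residue_norm g a) * \<psi> (Polynomial.coeff a j)) \<le>
     sqrt (real (CARD('a))) * norm (full_sum \<chi> j g) + real (CARD('a)) * (\<Sum>i<j. norm (full_sum \<chi> i g))"
proof -
  have "(\<Sum>a\<in>polys_below j. \<chi> (residue_norm g a) * \<psi> (Polynomial.coeff a j)) =
        (\<Sum>a\<in>polys_below j. \<chi> (residue_norm g a))"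
    by (intro sum.cong refl) (simp add: polys_below_def additive_character_0[OF psi])
  hence low: "norm (\<Sum>a\<in>polys_below j. \<chi> (residue_norm g a) * \<psi> (Polynomial.coeff a j)) \<le>
      real (CARD('a)) * (\<Sum>i<j. norm (full_sum \<chi> i g))"
    using norm_sum_polys_below_le[OF chi g m] by simp
  have "(\<Sum>c\<in>UNIV - {0}. \<Sum>h\<in>monic_polys j. \<chi> (residue_norm g (Polynomial.smult c h)) *
          \<psi> (Polynomial.coeff (Polynomial.smult c h) j)) =
        (\<Sum>c\<in>UNIV - {0}. \<Sum>h\<in>monic_polys j. (\<chi> c ^ m * \<psi> c) * \<chi> (residue_norm g h))"
  proof (intro sum.cong refl)
    fix c :: 'a and h :: "'a poly" assume "h \<in> monic_polys j"
    thus "\<chi> (residue_norm g (Polynomial.smult c h)) * \<psi> (Polynomial.coeff (Polynomial.smult c h) j) =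
        (\<chi> c ^ m * \<psi> c) * \<chi> (residue_norm g h)"
      using g by (auto simp: residue_norm_smult character_mult[OF chi] character_power[OF chi] monic_polys_def)
  qed
  also have "\<dots> = (\<Sum>c\<in>UNIV - {0}. \<chi> c ^ m * \<psi> c) * full_sum \<chi> j g"
    by (simp add: full_sum_def sum_product)
  also have "(\<Sum>c\<in>UNIV - {0}. \<chi> c ^ m * \<psi> c) = (\<Sum>c\<in>UNIV. \<chi> c ^ m * \<psi> c)"
    using m by (intro sum.mono_neutral_left) (auto simp: character_0[OF chi] power_0_left)
  finally have top: "norm (\<Sum>c\<in>UNIV - {0}. \<Sum>h\<in>monic_polys j. \<chi> (residue_norm g (Polynomial.smult c h)) *
          \<psi> (Polynomial.coeff (Polynomial.smult c h) j)) \<le> sqrt (real (CARD('a))) * norm (full_sum \<chi> j g)"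
    using norm_field_gauss_sum_le[OF mult_character_power[OF chi m] psi]
    by (simp add: norm_mult mult_right_mono)
  thus ?thesis unfolding sum_polys_below_Suc
    using norm_triangle_mono[OF low top] by (simp add: add.commute)
qed

section \<open>Mean square bounds\<close>

lemma L2_set_sum_le:
  assumes "finite J"
  shows "L2_set (\<lambda>x. \<Sum>j\<in>J. f j x) A \<le> (\<Sum>j\<in>J. L2_set (f j) A)"
  using assms
proof (induction J rule: finite_induct)
  case (insert j J)
  have "L2_set (\<lambda>x. f j x + (\<Sum>j\<in>J. f j x)) A \<le> L2_set (f j) A + L2_set (\<lambda>x. \<Sum>j\<in>J. f j x) A"
    by (rule L2_set_triangle_ineq)
  thus ?case using insert by simp
qed (simp add: L2_set_def)

text \<open>
  The \<open>\<ell>\<^sup>2\<close> norm of a function of \<open>g\<close>, without dividing by the number of \<open>g\<close>; square root size of a sum over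
  \<open>q\<^sup>k\<close> terms thus means \<open>q\<^bsup>(m + k)/2\<^esup>\<close>.
\<close>
definition root_mean :: "nat \<Rightarrow> ('a :: {finite, field} poly \<Rightarrow> complex) \<Rightarrow> real" where
  "root_mean m f = L2_set (\<lambda>g. norm (f g)) (monic_squarefree_polys m)"

lemma root_mean_nonneg [simp]: "root_mean m f \<ge> 0"
  by (simp add: root_mean_def)

lemma root_mean_le_sum:
  assumes "finite J"
    and "\<And>g. g \<in> monic_squarefree_polys m \<Longrightarrow> norm (F g) \<le> (\<Sum>j\<in>J. c j * norm (f j g))"
    and "\<And>j. j \<in> J \<Longrightarrow> c j \<ge> 0"
  shows "root_mean m F \<le> (\<Sum>j\<in>J. c j * root_mean m (f j))"
proof -
  have "root_mean m F \<le> L2_set (\<lambda>g. \<Sum>j\<in>J. c j * norm (f j g)) (monic_squarefree_polys m)"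
    unfolding root_mean_def by (intro L2_set_mono assms(2)) auto
  also have "\<dots> \<le> (\<Sum>j\<in>J. L2_set (\<lambda>g. c j * norm (f j g)) (monic_squarefree_polys m))"
    by (rule L2_set_sum_le[OF assms(1)])
  also have "\<dots> = (\<Sum>j\<in>J. c j * root_mean m (f j))"
    unfolding root_mean_def using assms(3) by (intro sum.cong refl) (simp add: L2_set_right_distrib)
  finally show ?thesis .
qed

lemma monic_polys_0: "monic_polys 0 = {1 :: 'a :: field poly}"
  by (auto simp: monic_poly_eq_monom_add)

lemma sum_powers_of_two: "(\<Sum>i<n. 2 ^ i) = (2 ^ n - 1 :: real)"
  by (induction n) auto

context
  fixes \<chi> :: "'a :: {finite, field} \<Rightarrow> complex" and m :: nat and s :: real
  assumes chi: "mult_character \<chi>" and nt: "nontrivial_character \<chi>" and m: "m > 0"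
    and s: "s = sqrt (real (CARD('a)))"
begin

lemma sqrt_card_ge_1: "s \<ge> 1"
  unfolding s using card_finite_field_gt_1[where 'a = 'a] by simp

lemma card_eq_sqrt_square: "real (CARD('a)) = s ^ 2"
  unfolding s by simp

lemma sqrt_even_power: "sqrt (s ^ (2 * k)) = s ^ k"
  using sqrt_card_ge_1 by (simp add: power_mult_distrib power_even_eq real_sqrt_abs)

lemma root_mean_sqfree_sum_short:
  assumes "2 * k \<le> m" shows "root_mean m (sqfree_sum \<chi> k) \<le> s ^ (m + k)"
proof -
  have "root_mean m (sqfree_sum \<chi> k) \<le> sqrt (s ^ (2 * (m + k)))"
    unfolding root_mean_def L2_set_def
    using sqfree_sum_mean_square[OF chi nt assms]
    by (intro real_sqrt_le_mono) (simp only: card_eq_sqrt_square power_mult)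
  thus ?thesis by (simp only: sqrt_even_power)
qed

lemma norm_full_sum_le:
  assumes "g \<in> monic_squarefree_polys m"
  shows "norm (full_sum \<chi> k g) \<le> (\<Sum>j\<le>k div 2. s ^ (2 * j) * norm (sqfree_sum \<chi> (k - 2 * j) g))"
proof -
  have lc: "lead_coeff g = 1" using assms by (auto simp: monic_squarefree_polys_def)
  show ?thesis
    unfolding full_sum_eq_sum_sqfree_sums[OF chi lc]
    using norm_square_sum_le[OF chi]
    by (intro sum_norm_le) (simp add: norm_mult mult_right_mono card_eq_sqrt_square power_mult)
qed

text \<open>
  Each of the \<open>k div 2 + 1\<close> terms of the square decomposition contributes at most the same power of \<open>s\<close>.
\<close>
lemma root_mean_full_sum_short:
  assumes "2 * k \<le> m" shows "root_mean m (full_sum \<chi> k) \<le> 2 ^ k * s ^ (m + k)"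
proof -
  have "root_mean m (full_sum \<chi> k) \<le>
      (\<Sum>j\<le>k div 2. s ^ (2 * j) * root_mean m (sqfree_sum \<chi> (k - 2 * j)))"
    using sqrt_card_ge_1 by (intro root_mean_le_sum norm_full_sum_le) auto
  also have "\<dots> \<le> (\<Sum>j\<le>k div 2. s ^ (m + k))"
  proof (rule sum_mono)
    fix j assume j: "j \<in> {..k div 2}"
    hence "s ^ (2 * j) * root_mean m (sqfree_sum \<chi> (k - 2 * j)) \<le> s ^ (2 * j) * s ^ (m + (k - 2 * j))"
      using assms sqrt_card_ge_1 by (intro mult_left_mono root_mean_sqfree_sum_short) auto
    also have "\<dots> = s ^ (m + k)" using j by (simp flip: power_add)
    finally show "s ^ (2 * j) * root_mean m (sqfree_sum \<chi> (k - 2 * j)) \<le> s ^ (m + k)" .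
  qed
  also have "\<dots> = real (Suc (k div 2)) * s ^ (m + k)" by simp
  also have "\<dots> \<le> 2 ^ k * s ^ (m + k)"
  proof (rule mult_right_mono)
    have "Suc (k div 2) \<le> Suc k" by simp
    also have "Suc k \<le> 2 ^ k" by (simp add: Suc_leI)
    finally show "real (Suc (k div 2)) \<le> 2 ^ k" by (metis of_nat_le_iff of_nat_numeral of_nat_power)
  qed (use sqrt_card_ge_1 in simp)
  finally show ?thesis .
qed

lemma norm_full_sum_functional_equation:
  assumes g: "g \<in> monic_squarefree_polys m" and k: "k < m"
  shows "s ^ (2 * (m - k)) * norm (full_sum \<chi> k g) \<le>
     (\<Sum>i<m - k. (if i = m - k - 1 then s ^ (m + 1) else s ^ (m + 2)) * norm (full_sum \<chi> i g))"
proof -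
  obtain \<psi> :: "'a \<Rightarrow> complex" where psi: "additive_character \<psi>"
    using additive_character_exists by blast
  define j where "j = m - k - 1"
  have j: "m - k = Suc j" using k by (simp add: j_def)
  have gm: "g \<in> monic_polys m" using g monic_squarefree_polys_subset by auto
  define D where "D = (\<Sum>a\<in>polys_below (Suc j). \<chi> (residue_norm g a) * \<psi> (Polynomial.coeff a j))"
  have "norm (gauss_sum \<chi> \<psi> g 1) \<le> sqrt (s ^ (2 * m))"
    using norm_gauss_sum_le[OF chi nt psi g m] by (intro real_le_rsqrt) (simp add: card_eq_sqrt_square power_mult)
  hence tau: "norm (gauss_sum \<chi> \<psi> g 1) \<le> s ^ m" by (simp only: sqrt_even_power)
  have "s ^ (2 * (m - k)) * norm (full_sum \<chi> k g) =
      norm (of_nat (CARD('a) ^ (m - k)) * full_sum \<chi> k g)"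
    by (simp add: norm_mult norm_power card_eq_sqrt_square power_mult)
  also have "\<dots> = norm (gauss_sum \<chi> \<psi> g 1) * norm D"
    unfolding functional_equation[OF chi nt psi g k] by (simp only: norm_mult complex_mod_cnj D_def j diff_Suc_1)
  also have "\<dots> \<le> s ^ m * (s * norm (full_sum \<chi> j g) + s ^ 2 * (\<Sum>i<j. norm (full_sum \<chi> i g)))"
    using norm_dual_sum_le[OF chi psi gm m, of j] sqrt_card_ge_1
    by (intro mult_mono tau) (simp_all add: D_def s flip: card_eq_sqrt_square)
  also have "\<dots> = (\<Sum>i<Suc j. (if i = j then s ^ (m + 1) else s ^ (m + 2)) * norm (full_sum \<chi> i g))"
    by (simp add: distrib_left sum_distrib_left power_add mult_ac power2_eq_square)
  finally show ?thesis by (simp add: j)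
qed

text \<open>
  In the range \<open>m < 2 k < 2 m\<close> the degrees \<open>i < m - k\<close> on the dual side satisfy \<open>2 i \<le> m\<close>. The powers of
  \<open>s\<close> balance exactly for \<open>i = m - k - 1\<close>; the additional factor \<open>s\<close> in front of the smaller \<open>i\<close> is paid for by
  the drop of the degree.
\<close>
lemma root_mean_full_sum: "root_mean m (full_sum \<chi> k) \<le> 2 ^ m * s ^ (m + k)"
proof -
  consider "k \<ge> m" | "2 * k \<le> m" "k < m" | "m < 2 * k" "k < m" by linarith
  thus ?thesis
  proof cases
    case 1
    have "root_mean m (full_sum \<chi> k) = 0"
      unfolding root_mean_def using full_sum_eq_0[OF chi nt _ m 1] by (intro L2_set_0') simp
    thus ?thesis using sqrt_card_ge_1 by simp
  next
    case 2
    have "(2 :: real) ^ k * s ^ (m + k) \<le> 2 ^ m * s ^ (m + k)"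
      using 2 sqrt_card_ge_1 by (intro mult_right_mono power_increasing) auto
    thus ?thesis using root_mean_full_sum_short[OF 2(1)] by linarith
  next
    case 3
    let ?c = "\<lambda>i. if i = m - k - 1 then s ^ (m + 1) else s ^ (m + 2)"
    have "s ^ (2 * (m - k)) * root_mean m (full_sum \<chi> k) =
        root_mean m (\<lambda>g. of_real (s ^ (2 * (m - k))) * full_sum \<chi> k g)"
      unfolding root_mean_def using sqrt_card_ge_1
      by (simp add: norm_mult norm_power L2_set_right_distrib)
    also have "\<dots> \<le> (\<Sum>i<m - k. ?c i * root_mean m (full_sum \<chi> i))"
    proof (rule root_mean_le_sum)
      fix g :: "'a poly" assume "g \<in> monic_squarefree_polys m"
      from norm_full_sum_functional_equation[OF this 3(2)]
      show "norm (of_real (s ^ (2 * (m - k))) * full_sum \<chi> k g) \<le>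
          (\<Sum>i<m - k. ?c i * norm (full_sum \<chi> i g))"
        using sqrt_card_ge_1 by (simp add: norm_mult norm_power)
    qed (use sqrt_card_ge_1 in auto)
    also have "\<dots> \<le> (\<Sum>i<m - k. 2 ^ i * s ^ (2 * m + (m - k)))"
    proof (rule sum_mono)
      fix i assume i: "i \<in> {..<m - k}"
      have "?c i * root_mean m (full_sum \<chi> i) \<le> ?c i * (2 ^ i * s ^ (m + i))"
        using i 3 sqrt_card_ge_1 by (intro mult_left_mono root_mean_full_sum_short) auto
      also have "\<dots> = 2 ^ i * (?c i * s ^ (m + i))" by simp
      also have "?c i * s ^ (m + i) \<le> s ^ (2 * m + (m - k))"
      proof (cases "i = m - k - 1")
        case True
        hence e: "m + 1 + (m + i) = 2 * m + (m - k)" using 3 by simp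
        have "?c i * s ^ (m + i) = s ^ (m + 1 + (m + i))" using True by (simp add: power_add)
        thus ?thesis unfolding e by simp
      next
        case False
        hence "m + 2 + (m + i) \<le> 2 * m + (m - k)" using i by auto
        hence "s ^ (m + 2 + (m + i)) \<le> s ^ (2 * m + (m - k))" using sqrt_card_ge_1 by (rule power_increasing)
        thus ?thesis using False by (simp only: power_add if_False)
      qed
      finally show "?c i * root_mean m (full_sum \<chi> i) \<le> 2 ^ i * s ^ (2 * m + (m - k))" by simp
    qed
    also have "\<dots> = (2 ^ (m - k) - 1) * s ^ (2 * m + (m - k))"
      by (simp only: sum_distrib_right[symmetric] sum_powers_of_two)
    also have "\<dots> \<le> 2 ^ m * s ^ (2 * m + (m - k))"
    proof (rule mult_right_mono)
      have "(2 :: real) ^ (m - k) \<le> 2 ^ m" by (rule power_increasing) auto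
      thus "(2 :: real) ^ (m - k) - 1 \<le> 2 ^ m" by linarith
    qed (use sqrt_card_ge_1 in simp)
    also have "\<dots> = s ^ (2 * (m - k)) * (2 ^ m * s ^ (m + k))"
    proof -
      have "2 * m + (m - k) = 2 * (m - k) + (m + k)" using 3 by simp
      thus ?thesis by (simp only: power_add mult_ac)
    qed
    finally show ?thesis using sqrt_card_ge_1 by (simp add: mult_le_cancel_left_pos)
  qed
qed

text \<open>
  Solve the square decomposition for its term \<open>j = 0\<close>, which is the wanted sum. The terms with \<open>j \<ge> 1\<close> are bounded
  by induction, and \<open>1 + \<Sum> 2\<^bsup>n - 2j\<^esup> \<le> 2\<^sup>n\<close> keeps the constant under control.
\<close>
lemma root_mean_sqfree_sum: "root_mean m (sqfree_sum \<chi> n) \<le> 2 ^ (m + n) * s ^ (m + n)"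
proof (induction n rule: less_induct)
  case (less n)
  let ?J = "{1..n div 2}"
  define f where "f j = (if j = 0 then full_sum \<chi> n else sqfree_sum \<chi> (n - 2 * j))" for j
  have "root_mean m (sqfree_sum \<chi> n) \<le> (\<Sum>j\<in>{..n div 2}. s ^ (2 * j) * root_mean m (f j))"
  proof (rule root_mean_le_sum)
    fix g :: "'a poly" assume g: "g \<in> monic_squarefree_polys m"
    have lc: "lead_coeff g = 1" using g by (auto simp: monic_squarefree_polys_def)
    have split: "{..n div 2} = insert 0 ?J" by auto
    have "square_sum \<chi> 0 g = 1"
      using lc by (simp add: square_sum_def monic_polys_0 character_1[OF chi])
    hence "sqfree_sum \<chi> n g = full_sum \<chi> n g - (\<Sum>j\<in>?J. square_sum \<chi> j g * sqfree_sum \<chi> (n - 2 * j) g)"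
      unfolding full_sum_eq_sum_sqfree_sums[OF chi lc] split by simp
    hence "norm (sqfree_sum \<chi> n g) \<le>
        norm (full_sum \<chi> n g) + norm (\<Sum>j\<in>?J. square_sum \<chi> j g * sqfree_sum \<chi> (n - 2 * j) g)"
      by (simp add: norm_triangle_ineq4)
    also have "norm (\<Sum>j\<in>?J. square_sum \<chi> j g * sqfree_sum \<chi> (n - 2 * j) g) \<le>
        (\<Sum>j\<in>?J. s ^ (2 * j) * norm (sqfree_sum \<chi> (n - 2 * j) g))"
      using norm_square_sum_le[OF chi]
      by (intro sum_norm_le) (simp add: norm_mult mult_right_mono card_eq_sqrt_square power_mult)
    also have "norm (full_sum \<chi> n g) + \<dots> = (\<Sum>j\<in>{..n div 2}. s ^ (2 * j) * norm (f j g))"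
      unfolding split by (simp add: f_def)
    finally show "norm (sqfree_sum \<chi> n g) \<le> (\<Sum>j\<in>{..n div 2}. s ^ (2 * j) * norm (f j g))" by simp
  qed (use sqrt_card_ge_1 in auto)
  also have "\<dots> = root_mean m (full_sum \<chi> n) +
      (\<Sum>j\<in>?J. s ^ (2 * j) * root_mean m (sqfree_sum \<chi> (n - 2 * j)))"
  proof -
    have "{..n div 2} = insert 0 ?J" by auto
    thus ?thesis by (simp add: f_def)
  qed
  also have "\<dots> \<le> 2 ^ m * s ^ (m + n) + (\<Sum>j\<in>?J. 2 ^ m * s ^ (m + n) * 2 ^ (n - 2 * j))"
  proof (intro add_mono sum_mono root_mean_full_sum)
    fix j assume j: "j \<in> ?J"
    hence j': "n - 2 * j < n" "2 * j \<le> n" by auto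
    have "s ^ (2 * j) * root_mean m (sqfree_sum \<chi> (n - 2 * j)) \<le>
        s ^ (2 * j) * (2 ^ (m + (n - 2 * j)) * s ^ (m + (n - 2 * j)))"
      using less[OF j'(1)] sqrt_card_ge_1 by (intro mult_left_mono) auto
    also have "\<dots> = 2 ^ (m + (n - 2 * j)) * (s ^ (2 * j) * s ^ (m + (n - 2 * j)))" by simp
    also have "s ^ (2 * j) * s ^ (m + (n - 2 * j)) = s ^ (m + n)"
      using j'(2) by (simp flip: power_add)
    finally show "s ^ (2 * j) * root_mean m (sqfree_sum \<chi> (n - 2 * j)) \<le> 2 ^ m * s ^ (m + n) * 2 ^ (n - 2 * j)"
      by (simp add: power_add mult_ac)
  qed
  also have "\<dots> = 2 ^ m * s ^ (m + n) * (1 + (\<Sum>j\<in>?J. 2 ^ (n - 2 * j)))"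
    by (simp add: sum_distrib_left distrib_left)
  also have "\<dots> \<le> 2 ^ m * s ^ (m + n) * 2 ^ n"
  proof (rule mult_left_mono)
    have inj: "inj_on (\<lambda>j. n - 2 * j) ?J" by (rule inj_onI) auto
    have "(\<Sum>j\<in>?J. 2 ^ (n - 2 * j)) = (\<Sum>i\<in>(\<lambda>j. n - 2 * j) ` ?J. 2 ^ i :: real)"
      by (subst sum.reindex[OF inj]) simp
    also have "\<dots> \<le> (\<Sum>i<n. 2 ^ i)" by (intro sum_mono2) auto
    also have "\<dots> = 2 ^ n - 1" by (rule sum_powers_of_two)
    finally show "1 + (\<Sum>j\<in>?J. 2 ^ (n - 2 * j)) \<le> (2 ^ n :: real)" by simp
  qed (use sqrt_card_ge_1 in simp)
  also have "\<dots> = 2 ^ (m + n) * s ^ (m + n)" by (simp add: power_add)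
  finally show ?case .
qed

section \<open>The resultant sum\<close>

text \<open>
  Cauchy-Schwarz over the at most \<open>q\<^sup>m\<close> polynomials \<open>g\<close>.
\<close>
lemma norm_resultant_sum_le:
  "norm (resultant_sum \<chi> n m) \<le> 2 ^ (m + n) * s ^ (2 * m + n)"
proof -
  let ?G = "monic_squarefree_polys m :: 'a poly set"
  have "resultant_sum \<chi> n m =
      (\<Sum>g\<in>?G. \<Sum>f\<in>monic_squarefree_polys n. \<chi> (poly_resultant f g))"
    unfolding resultant_sum_def by (rule sum.swap)
  also have "\<dots> = (\<Sum>g\<in>?G. \<chi> ((-1) ^ (n * m)) * sqfree_sum \<chi> n g)"
    unfolding sqfree_sum_def sum_distrib_left
  proof (intro sum.cong refl)
    fix g f :: "'a poly" assume gf: "g \<in> ?G" "f \<in> monic_squarefree_polys n"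
    hence gf': "g \<in> monic_polys m" "f \<in> monic_polys n" using monic_squarefree_polys_subset by auto
    have "poly_resultant f g = residue_norm f g"
      using gf' by (intro poly_resultant_eq_residue_norm) (auto simp: monic_polys_def)
    also have "\<dots> = (-1) ^ (n * m) * residue_norm g f" by (rule residue_norm_swap[OF gf'(2,1)])
    finally show "\<chi> (poly_resultant f g) = \<chi> ((-1) ^ (n * m)) * \<chi> (residue_norm g f)"
      by (simp only: character_mult[OF chi])
  qed
  finally have "norm (resultant_sum \<chi> n m) \<le> (\<Sum>g\<in>?G. norm (\<chi> ((-1) ^ (n * m)) * sqfree_sum \<chi> n g))"
    using norm_sum by metis
  also have "\<dots> = (\<Sum>g\<in>?G. \<bar>1\<bar> * \<bar>norm (sqfree_sum \<chi> n g)\<bar>)"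
    by (simp add: norm_mult norm_character[OF chi])
  also have "\<dots> \<le> L2_set (\<lambda>g. 1) ?G * root_mean m (sqfree_sum \<chi> n)"
    unfolding root_mean_def by (rule L2_set_mult_ineq)
  also have "\<dots> \<le> s ^ m * (2 ^ (m + n) * s ^ (m + n))"
  proof (rule mult_mono)
    have "real (card ?G) \<le> real (CARD('a) ^ m)"
      using card_monic_squarefree_polys_le[of m, where 'a = 'a] by (simp only: of_nat_le_iff)
    hence "sqrt (real (card ?G)) \<le> sqrt (s ^ (2 * m))"
      by (intro real_sqrt_le_mono) (simp add: card_eq_sqrt_square power_mult)
    thus "L2_set (\<lambda>g. 1) ?G \<le> s ^ m" unfolding sqrt_even_power by (simp add: L2_set_constant)
  qed (use root_mean_sqfree_sum sqrt_card_ge_1 in auto)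
  also have "\<dots> = 2 ^ (m + n) * s ^ (2 * m + n)" by (simp add: power_add mult_2)
  finally show ?thesis .
qed

end

lemma norm_resultant_sum_swap:
  fixes \<chi> :: "'a :: {finite, field} \<Rightarrow> complex"
  assumes chi: "mult_character \<chi>"
  shows "norm (resultant_sum \<chi> n m) = norm (resultant_sum \<chi> m n)"
proof -
  have "resultant_sum \<chi> n m =
      (\<Sum>g\<in>monic_squarefree_polys m. \<Sum>f\<in>monic_squarefree_polys n. \<chi> (poly_resultant f g))"
    unfolding resultant_sum_def by (rule sum.swap)
  also have "\<dots> = \<chi> ((-1) ^ (n * m)) * resultant_sum \<chi> m n"
    unfolding resultant_sum_def sum_distrib_left
  proof (intro sum.cong refl)
    fix g f :: "'a poly" assume "g \<in> monic_squarefree_polys m" "f \<in> monic_squarefree_polys n"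
    hence gf: "g \<in> monic_polys m" "f \<in> monic_polys n" using monic_squarefree_polys_subset by auto
    have "poly_resultant f g = (-1) ^ (n * m) * poly_resultant g f"
      using residue_norm_swap[OF gf(2,1)] gf
      by (simp add: poly_resultant_eq_residue_norm monic_polys_lead)
    thus "\<chi> (poly_resultant f g) = \<chi> ((-1) ^ (n * m)) * \<chi> (poly_resultant g f)"
      by (simp only: character_mult[OF chi])
  qed
  finally show ?thesis by (simp add: norm_mult norm_character[OF chi])
qed

text \<open>
  The quotient in the theorem is a geometric sum whose largest term is \<open>y / s\<close>.
\<close>
lemma geometric_quotient_ge:
  fixes s :: real assumes "s > 1" "y \<ge> s * x" "x \<ge> 1"
  shows "x \<le> (y - 1) / (s - 1)"
proof -
  have "x * (s - 1) \<le> s * x - 1" using assms by (simp add: algebra_simps)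
  also have "\<dots> \<le> y - 1" using assms by simp
  finally show ?thesis using assms(1) by (simp add: pos_le_divide_eq)
qed

theorem theorem1p1:
  fixes \<chi> :: "'a :: {finite, field} \<Rightarrow> complex" and n m q :: nat
  assumes "q = CARD('a)"
    and "n \<ge> 1" and "m \<ge> 1"
    and "mult_character \<chi>" and "nontrivial_character \<chi>"
  shows "(quadratic_character \<chi> \<longrightarrow>
            norm (resultant_sum \<chi> n m) \<le>
              2 ^ (2 * n + 2 * m - 1) *
              ((real q powr (real n + real m + 1 - real (max n m) / 2) - 1) / (sqrt (real q) - 1))) \<and>
         (\<not> quadratic_character \<chi> \<longrightarrow>
            norm (resultant_sum \<chi> n m) \<le>
              2 ^ (2 * n + 2 * m - 1) *
              ((real q powr (real n + real m + (1 - real (max n m)) / 2) - 1) / (sqrt (real q) - 1)))"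
proof -
  define s where "s = sqrt (real q)"
  define M where "M = max n m"
  define N where "N = min n m"
  have MN: "M + N = n + m" "real M + real N = real n + real m" "M \<ge> 1" "N \<ge> 1" "N > 0"
    using assms(2,3) by (auto simp: M_def N_def max_def min_def)
  have q: "real q > 1" using card_finite_field_gt_1[where 'a = 'a] assms(1) by simp
  hence s: "s > 1" by (simp add: s_def)
  have powr_s: "real q powr (real k / 2) = s ^ k" for k
  proof -
    have "real q powr (real k / 2) = (real q powr (1 / 2)) powr real k" by (simp add: powr_powr)
    thus ?thesis using q s by (simp add: powr_half_sqrt s_def powr_realpow)
  qed
  have "norm (resultant_sum \<chi> n m) = norm (resultant_sum \<chi> M N)"
    using norm_resultant_sum_swap[OF assms(4), of n m] by (auto simp: M_def N_def max_def min_def)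
  also have "\<dots> \<le> 2 ^ (N + M) * s ^ (2 * N + M)"
    by (rule norm_resultant_sum_le[OF assms(4,5) MN(5)]) (simp add: s_def assms(1))
  finally have bound: "norm (resultant_sum \<chi> n m) \<le> 2 ^ (N + M) * s ^ (2 * N + M)" .
  \<comment> \<open>Both exponents in the claim are at least \<open>N + M/2 + 1/2\<close>, half a power of \<open>q\<close> above the bound.\<close>
  have main: "norm (resultant_sum \<chi> n m) \<le> 2 ^ (2 * n + 2 * m - 1) * ((real q powr e - 1) / (s - 1))"
    if e: "e \<ge> real (2 * N + M + 1) / 2" for e
  proof -
    have "s * s ^ (2 * N + M) = real q powr (real (2 * N + M + 1) / 2)" by (simp only: powr_s) simp
    also have "\<dots> \<le> real q powr e" using e q by (intro powr_mono) auto
    finally have "s ^ (2 * N + M) \<le> (real q powr e - 1) / (s - 1)"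
      using s by (intro geometric_quotient_ge) (auto intro: one_le_power)
    moreover have "N + M \<le> 2 * n + 2 * m - 1" using MN assms(2,3) by linarith
    hence "(2 :: real) ^ (N + M) \<le> 2 ^ (2 * n + 2 * m - 1)" by (intro power_increasing) auto
    ultimately have "2 ^ (N + M) * s ^ (2 * N + M) \<le> 2 ^ (2 * n + 2 * m - 1) * ((real q powr e - 1) / (s - 1))"
      using s by (intro mult_mono) auto
    thus ?thesis using bound by linarith
  qed
  have "real n + real m + 1 - real (max n m) / 2 \<ge> real (2 * N + M + 1) / 2"
    "real n + real m + (1 - real (max n m)) / 2 \<ge> real (2 * N + M + 1) / 2"
    unfolding M_def[symmetric] MN(2)[symmetric] by (simp_all add: field_simps)
  thus ?thesis using main unfolding s_def by blast
qed

end
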